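(* Assume that ${\rm conv}(A)$ is a simplex and that $w\in\mathbf R^n$ is a generic weight vector such that the regular triangulation $\Delta_w$ is ${\rm conv}(A)$ itself. Let $\beta\in\mathbf k^d$. Then a fake exponent of $M_A(\beta)$ with respect to $w$ which does not have minimal negative support is never an exponent.
   Context: Let $\mathbf N=\{0,1,2,\dots\}$ and let $\mathbf k$ be a field of characteristic zero. Let $A=(a_1,\dots,a_n)=(a_{ij})$ be a $d\times n$ integer matrix of rank $d$ whose columns all lie on one hyperplane of $\mathbf Q^d$ not containing the origin; $A$ also denotes the set of its columns. Put $L=\{u\in\mathbf Z^n : Au=0\}$. $I_A=\langle \partial^u-\partial^v : u,v\in\mathbf N^n,\ Au=Av\rangle\subset\mathbf k[\partial]=\mathbf k[\partial_1,\dots,\partial_n]$. For $\beta\in\mathbf k^d$, $H_A(\beta)$ is the left ideal of the Weyl algebra $D=\mathbf k\langle x_1,\dots,x_n,\partial_1,\dots,\partial_n\rangle$ generated by $I_A$ and $\sum_{j}a_{ij}\theta_j-\beta_i$ ($i=1,\dots,d$), with $\theta_j=x_j\partial_j$; $M_A(\beta)=D/H_A(\beta)$. A formal series annihilated by $H_A(\beta)$ is called $A$-hypergeometric with parameter $\beta$. $\partial_j$ has $w$-weight $w_j$, and ${\rm in}_w(I_A)$ is the ideal generated by the initial forms (parts of highest $w$-weight) of elements of $I_A$. Generic means that the initial ideals ${\rm in}_w(I_A)$ and ${\rm in}_{(-w,w)}(H_A(\beta))$ do not change under small perturbations of $w$ (so ${\rm in}_w(I_A)$ is a monomial ideal). $\Delta_w$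 is the regular triangulation of ${\rm conv}(A)$ determined by $w$: ${\rm conv}\{a_j : j\in I\}$ is a face of $\Delta_w$ with vertices $a_j$ ($j\in I$) iff there is $c\in\mathbf R^d$ with $c\cdot a_j=w_j$ for $j\in I$ and $c\cdot a_j<w_j$ for $j\notin I$; $\emptyset$ is also a face. "$\Delta_w$ is ${\rm conv}(A)$ itself" means that $\Delta_w$ consists of the simplex ${\rm conv}(A)$ and its faces. A fake exponent of $M_A(\beta)$ with respect to $w$ is a zero $v\in\mathbf k^n$ of the fake indicial ideal $(D\cdot{\rm in}_w(I_A)\cap\mathbf k[\theta])+\langle A\theta-\beta\rangle\subset\mathbf k[\theta]=\mathbf k[\theta_1,\dots,\theta_n]$, where $\langle A\theta-\beta\rangle$ is generated by $\sum_ja_{ij}\theta_j-\beta_i$. A fake exponent $v$ is an exponent if there is an $A$-hypergeometric series $x^v\sum_{u\in L}g_u(\log x)x^u$ ($g_u\in\mathbf k[x]$) with parameter $\beta$, with $g_0\neq0$, in the direction of $w$, i.e. such that there is a basis $u^{(1)},\dots,u^{(n)}$ of $\mathbf Q^n$ with $w\cdot u^{(j)}>0$ for all $j$ and $g_u=0$ whenever $u\notin\sum_j\mathbf Q_{\ge0}u^{(j)}$. For $v\in\mathbf k^n$, ${\rm nsupp}(v)=\{i : v_i\in\mathbf Z_{<0}\}$; $v$ has minimal negative support if ${\rm nsupp}(v)$ is minimal with respect to inclusion among ${\rm nsupp}(v+u)$, $u\in L$. *)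

theory Defs
  imports "HOL-Analysis.Analysis" "HOL-Library.Poly_Mapping"
begin

section \<open>Polynomials and ideals\<close>

text \<open>Multi-indices in $\mathbf{N}^n$ are vectors of type \<open>nat ^ 'n\<close>; their componentwise addition
  makes the finitely supported maps on them the ring of polynomials in variables indexed by \<open>'n\<close>.\<close>

type_synonym ('k, 'n) mpoly = "(nat ^ 'n) \<Rightarrow>\<^sub>0 'k"

definition vmap :: "('a \<Rightarrow> 'b) \<Rightarrow> 'a ^ 'n \<Rightarrow> 'b ^ 'n" where
  "vmap f x = (\<chi> i. f (x $ i))"

definition mpoly_eval :: "'k::comm_ring_1 ^ 'n \<Rightarrow> ('k, 'n::finite) mpoly \<Rightarrow> 'k" where
  "mpoly_eval v p = (\<Sum>m\<in>Poly_Mapping.keys p. Poly_Mapping.lookup p m * (\<Prod>j\<in>UNIV. (v $ j) ^ (m $ j)))"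

definition mpoly_scale :: "'k::comm_ring_1 \<Rightarrow> ('k, 'n::finite) mpoly \<Rightarrow> ('k, 'n) mpoly" where
  "mpoly_scale c p = Poly_Mapping.map ((*) c) p"

definition mpoly_pderiv :: "'n \<Rightarrow> ('k::comm_ring_1, 'n::finite) mpoly \<Rightarrow> ('k, 'n) mpoly" where
  "mpoly_pderiv j p = (\<Sum>m\<in>Poly_Mapping.keys p.
     Poly_Mapping.single (m - axis j 1) (of_nat (m $ j) * Poly_Mapping.lookup p m))"

definition left_ideal :: "'a::ring_1 set \<Rightarrow> bool" where
  "left_ideal I \<longleftrightarrow> 0 \<in> I \<and> (\<forall>a\<in>I. \<forall>b\<in>I. a + b \<in> I) \<and> (\<forall>r. \<forall>a\<in>I. r * a \<in> I)"

text \<open>The part of highest weight, for an arbitrary weight on the monomials \<open>'m\<close>.\<close>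

definition initial_form :: "('m \<Rightarrow> real) \<Rightarrow> ('m \<Rightarrow>\<^sub>0 'k::comm_monoid_add) \<Rightarrow> ('m \<Rightarrow>\<^sub>0 'k)" where
  "initial_form wt p = (\<Sum>m\<in>{m \<in> Poly_Mapping.keys p. \<forall>m'\<in>Poly_Mapping.keys p. wt m' \<le> wt m}.
     Poly_Mapping.single m (Poly_Mapping.lookup p m))"

section \<open>The Weyl algebra\<close>

text \<open>An operator is stored by its normal form: the coefficient at \<open>(a, b)\<close> is that of
  $x^a \partial^b$. Products are given by the Leibniz formula
  $x^a \partial^b \cdot x^c \partial^e = \sum_{k \le b, c} \prod_i \binom{b_i}{k_i} \binom{c_i}{k_i} k_i! \;
   x^{a+c-k} \partial^{b+e-k}$.\<close>

typedef (overloaded) ('k::zero, 'n::finite) weyl = "UNIV :: (((nat ^ 'n) \<times> (nat ^ 'n)) \<Rightarrow>\<^sub>0 'k) set"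
  morphisms weyl_coeffs Weyl
  by simp

setup_lifting type_definition_weyl

definition leibniz_coeff :: "nat ^ 'n \<Rightarrow> nat ^ 'n \<Rightarrow> nat ^ 'n \<Rightarrow> nat" where
  "leibniz_coeff b c k = (\<Prod>i\<in>UNIV. (b $ i choose k $ i) * (c $ i choose k $ i) * fact (k $ i))"

definition normal_times ::
  "(((nat ^ 'n) \<times> (nat ^ 'n)) \<Rightarrow>\<^sub>0 'k::comm_ring_1) \<Rightarrow> (((nat ^ 'n) \<times> (nat ^ 'n)) \<Rightarrow>\<^sub>0 'k)
    \<Rightarrow> (((nat ^ 'n::finite) \<times> (nat ^ 'n)) \<Rightarrow>\<^sub>0 'k)" where
  "normal_times p q = (\<Sum>(a, b)\<in>Poly_Mapping.keys p. \<Sum>(c, e)\<in>Poly_Mapping.keys q.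
     \<Sum>k\<in>{k. k \<le> b \<and> k \<le> c}. Poly_Mapping.single (a + c - k, b + e - k)
       (Poly_Mapping.lookup p (a, b) * Poly_Mapping.lookup q (c, e) * of_nat (leibniz_coeff b c k)))"

text \<open>The ring axioms are checked on the action of operators on formal two-sided series
  $\sum_{m \in \mathbf{Z}^n} \varphi_m x^m$, which is faithful in characteristic zero.\<close>

definition ff :: "'k::comm_ring_1 \<Rightarrow> nat \<Rightarrow> 'k" where
  "ff z n = (\<Prod>i<n. z - of_nat i)"

definition ffv :: "int ^ 'n::finite \<Rightarrow> nat ^ 'n \<Rightarrow> 'k::comm_ring_1" where
  "ffv z b = (\<Prod>i\<in>UNIV. ff (of_int (z $ i)) (b $ i))"

definition laurent_monom ::
  "(nat ^ 'n) \<times> (nat ^ 'n) \<Rightarrow> (int ^ 'n::finite \<Rightarrow> 'k::comm_ring_1) \<Rightarrow> int ^ 'n \<Rightarrow> 'k" where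
  "laurent_monom = (\<lambda>(a, b) \<phi> m. ffv (m - vmap int a + vmap int b) b * \<phi> (m - vmap int a + vmap int b))"

definition laurent_act ::
  "(((nat ^ 'n) \<times> (nat ^ 'n)) \<Rightarrow>\<^sub>0 'k::comm_ring_1) \<Rightarrow> (int ^ 'n::finite \<Rightarrow> 'k) \<Rightarrow> int ^ 'n \<Rightarrow> 'k" where
  "laurent_act p \<phi> m = (\<Sum>x\<in>Poly_Mapping.keys p. Poly_Mapping.lookup p x * laurent_monom x \<phi> m)"

lemma ff_pochhammer: "ff z n = (-1) ^ n * pochhammer (- z) n"
proof -
  have "(\<Prod>i<n. z - of_nat i) = (\<Prod>i<n. (-1) * (- z + of_nat i))"
    by (intro prod.cong) auto
  also have "\<dots> = (-1) ^ n * (\<Prod>i<n. - z + of_nat i)"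
    by (subst prod.distrib) simp
  finally show ?thesis
    by (simp add: ff_def pochhammer_prod atLeast0LessThan)
qed

lemma ff_add: "ff z (m + n) = ff z m * ff (z - of_nat m) n"
  by (simp add: ff_pochhammer pochhammer_product' power_add algebra_simps)

lemma ff_Vandermonde:
  "ff (x + y) n = (\<Sum>k\<le>n. of_nat (n choose k) * ff x k * ff y (n - k) :: 'k::comm_ring_1)"
proof -
  have "(-1) ^ n * (of_nat (n choose k) * pochhammer (- x) k * pochhammer (- y) (n - k))
      = of_nat (n choose k) * ff x k * ff y (n - k)" if "k \<le> n" for k
  proof -
    have "(-1 :: 'k) ^ n = (-1) ^ k * (-1) ^ (n - k)"
      using that by (simp flip: power_add)
    then show ?thesis by (simp add: ff_pochhammer algebra_simps)
  qed
  then have "(-1) ^ n * (\<Sum>k\<le>n. of_nat (n choose k) * pochhammer (- x) k * pochhammer (- y) (n - k))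
      = (\<Sum>k\<le>n. of_nat (n choose k) * ff x k * ff y (n - k))"
    unfolding sum_distrib_left by (intro sum.cong) auto
  then show ?thesis
    using pochhammer_binomial_sum[of "- x" "- y" n] by (simp add: ff_pochhammer)
qed

lemma ff_nat: "ff (of_nat c) k = of_nat ((c choose k) * fact k)"
proof (cases "k \<le> c")
  case False
  then have "\<exists>i\<in>{..<k}. (of_nat c - of_nat i :: 'a) = 0"
    by (intro bexI[of _ c]) auto
  then have "ff (of_nat c) k = (0 :: 'a)"
    unfolding ff_def by (intro prod_zero) auto
  then show ?thesis using False by (simp add: binomial_eq_0)
next
  case True
  then show ?thesis
  proof (induction k)
    case (Suc k)
    have "(c choose Suc k) * fact (Suc k) = (c choose k) * fact k * (c - k)"
      using Suc.prems
      by (metis (no_types, lifting) binomial_absorb_comp binomial_absorption fact_Suc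
          mult.assoc mult.commute mult.left_commute of_nat_id)
    moreover have "ff (of_nat c) (Suc k) = ff (of_nat c) k * (of_nat (c - k) :: 'a)"
      using Suc.prems by (simp add: ff_def of_nat_diff)
    ultimately show ?case using Suc by simp
  qed (simp add: ff_def)
qed


lemma ffv_Vandermonde:
  "ffv (y + vmap int c) b
   = (\<Sum>k\<in>{k. k \<le> b \<and> k \<le> c}. of_nat (leibniz_coeff b c k) * ffv y (b - k) :: 'k::comm_ring_1)"
proof -
  define t where "t i k = (of_nat ((b $ i choose k) * (c $ i choose k) * fact k)
      * ff (of_int (y $ i)) (b $ i - k) :: 'k)" for i k
  have bij: "bij_betw (\<lambda>k. ($) k) {k. k \<le> b} (PiE UNIV (\<lambda>i. {..b $ i}))"
    by (rule bij_betwI[where g = vec_lambda]) (auto simp: less_eq_vec_def)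
  have fin: "finite {k. k \<le> b}"
    using bij_betw_finite[OF bij] by (simp add: finite_PiE)
  have "ffv (y + vmap int c) b = (\<Prod>i\<in>UNIV. ff (of_nat (c $ i) + of_int (y $ i)) (b $ i) :: 'k)"
    by (simp add: ffv_def vmap_def add.commute)
  also have "\<dots> = (\<Prod>i\<in>UNIV. \<Sum>k\<le>b $ i. t i k)"
    by (simp add: ff_Vandermonde ff_nat t_def mult.assoc)
  also have "\<dots> = (\<Sum>g\<in>PiE UNIV (\<lambda>i. {..b $ i}). \<Prod>i\<in>UNIV. t i (g i))"
    by (intro prod_sum_PiE) auto
  also have "\<dots> = (\<Sum>k\<in>{k. k \<le> b}. \<Prod>i\<in>UNIV. t i (k $ i))"
    by (rule sum.reindex_bij_betw[OF bij, symmetric])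
  also have "\<dots> = (\<Sum>k\<in>{k. k \<le> b}. of_nat (leibniz_coeff b c k) * ffv y (b - k))"
    by (simp add: t_def prod.distrib leibniz_coeff_def ffv_def)
  also have "\<dots> = (\<Sum>k\<in>{k. k \<le> b \<and> k \<le> c}. of_nat (leibniz_coeff b c k) * ffv y (b - k))"
  proof (rule sum.mono_neutral_right[OF fin _ ballI])
    show "{k. k \<le> b \<and> k \<le> c} \<subseteq> {k. k \<le> b}" by auto
  next
    fix k assume "k \<in> {k. k \<le> b} - {k. k \<le> b \<and> k \<le> c}"
    then have "\<not> k \<le> c" by auto
    then obtain i where "c $ i < k $ i" by (auto simp: less_eq_vec_def not_le)
    then have "leibniz_coeff b c k = 0"
      unfolding leibniz_coeff_def by (intro prod_zero) (auto simp: binomial_eq_0)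
    then show "of_nat (leibniz_coeff b c k) * ffv y (b - k) = (0 :: 'k)" by simp
  qed
  finally show ?thesis .
qed

lemma ffv_add: "ffv z (b + c) = ffv z b * ffv (z - vmap int b) c"
  by (simp add: ffv_def vmap_def ff_add prod.distrib)

lemma laurent_monom_compose:
  "laurent_monom (a, b) (laurent_monom (c, e) \<phi>) m
   = (\<Sum>k\<in>{k. k \<le> b \<and> k \<le> c}. of_nat (leibniz_coeff b c k) * laurent_monom (a + c - k, b + e - k) \<phi> m)"
proof -
  define z where "z = m - vmap int a + vmap int b - vmap int c + vmap int e"
  have z: "m - vmap int (a + c - k) + vmap int (b + e - k) = z" if "k \<le> b" "k \<le> c" for k
  proof -
    have "k $ i \<le> b $ i" "k $ i \<le> c $ i" for i using that by (auto simp: less_eq_vec_def)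
    then have "int (a $ i + c $ i - k $ i) = int (a $ i) + int (c $ i) - int (k $ i)"
       "int (b $ i + e $ i - k $ i) = int (b $ i) + int (e $ i) - int (k $ i)" for i
      by (simp_all add: of_nat_diff trans_le_add1 trans_le_add2)
    then show ?thesis by (simp add: vec_eq_iff z_def vmap_def)
  qed
  have split: "b + e - k = e + (b - k)" if "k \<le> b" for k
    using that by (auto simp: vec_eq_iff less_eq_vec_def add.commute)
  have "laurent_monom (a, b) (laurent_monom (c, e) \<phi>) m
      = ffv ((z - vmap int e) + vmap int c) b * (ffv z e * \<phi> z)"
    by (simp add: laurent_monom_def z_def)
  also have "\<dots> = (\<Sum>k\<in>{k. k \<le> b \<and> k \<le> c}. of_nat (leibniz_coeff b c k) * ffv z (e + (b - k)) * \<phi> z)"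
    unfolding ffv_Vandermonde sum_distrib_right ffv_add by (intro sum.cong) (auto simp: algebra_simps)
  also have "\<dots> = (\<Sum>k\<in>{k. k \<le> b \<and> k \<le> c}. of_nat (leibniz_coeff b c k)
      * laurent_monom (a + c - k, b + e - k) \<phi> m)"
    by (intro sum.cong) (auto simp: laurent_monom_def z, simp add: split mult.assoc)
  finally show ?thesis .
qed

lemma laurent_monom_compose_pair:
  "laurent_monom x (laurent_monom y \<phi>) m
   = (\<Sum>k\<in>{k. k \<le> snd x \<and> k \<le> fst y}. of_nat (leibniz_coeff (snd x) (fst y) k)
        * laurent_monom (fst x + fst y - k, snd x + snd y - k) \<phi> m)"
  using laurent_monom_compose[of "fst x" "snd x" "fst y" "snd y"] by simp

lemma laurent_act_superset:
  assumes "finite S" "Poly_Mapping.keys p \<subseteq> S"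
  shows "laurent_act p \<phi> m = (\<Sum>x\<in>S. Poly_Mapping.lookup p x * laurent_monom x \<phi> m)"
  unfolding laurent_act_def by (rule sum.mono_neutral_left[OF assms]) (auto simp: in_keys_iff)

lemma laurent_act_add: "laurent_act (p + q) \<phi> m = laurent_act p \<phi> m + laurent_act q \<phi> m"
proof -
  let ?S = "Poly_Mapping.keys p \<union> Poly_Mapping.keys q"
  have "Poly_Mapping.keys (p + q) \<subseteq> ?S" by (rule Poly_Mapping.keys_add)
  then show ?thesis
    by (simp add: laurent_act_superset[of ?S] lookup_add distrib_right sum.distrib)
qed

lemma laurent_act_zero [simp]: "laurent_act 0 \<phi> m = 0"
  by (simp add: laurent_act_def)

lemma laurent_act_sum: "laurent_act (\<Sum>i\<in>I. p i) \<phi> m = (\<Sum>i\<in>I. laurent_act (p i) \<phi> m)"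
  by (induction I rule: infinite_finite_induct) (auto simp: laurent_act_add)

lemma laurent_act_single: "laurent_act (Poly_Mapping.single x c) \<phi> m = c * laurent_monom x \<phi> m"
  by (simp add: laurent_act_superset[of "{x}"])

lemma laurent_act_uminus: "laurent_act (- p) \<phi> m = - laurent_act p \<phi> m"
  using laurent_act_add[of "- p" p \<phi> m] by (simp add: eq_neg_iff_add_eq_0)

lemma laurent_act_fun_add:
  "laurent_act p (\<lambda>m. \<phi> m + \<psi> m) m = laurent_act p \<phi> m + laurent_act p \<psi> m"
  by (simp add: laurent_act_def laurent_monom_def split_def distrib_left sum.distrib)

lemma laurent_monom_sum:
  "laurent_monom x (\<lambda>m. \<Sum>i\<in>I. r i * \<phi> i m) m = (\<Sum>i\<in>I. r i * laurent_monom x (\<phi> i) m)"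
  by (simp add: laurent_monom_def split_def sum_distrib_left mult.left_commute)

lemma laurent_act_times: "laurent_act (normal_times p q) \<phi> m = laurent_act p (laurent_act q \<phi>) m"
proof -
  let ?c = "Poly_Mapping.lookup p" and ?d = "Poly_Mapping.lookup q"
  have "laurent_act (normal_times p q) \<phi> m
      = (\<Sum>x\<in>Poly_Mapping.keys p. \<Sum>y\<in>Poly_Mapping.keys q.
          ?c x * (?d y * laurent_monom x (laurent_monom y \<phi>) m))"
    unfolding normal_times_def laurent_act_sum split_def laurent_act_single
    by (intro sum.cong refl)
       (simp add: laurent_monom_compose_pair sum_distrib_left mult.assoc)
  also have "\<dots> = (\<Sum>x\<in>Poly_Mapping.keys p. ?c x * laurent_monom x (laurent_act q \<phi>) m)"
    by (simp add: laurent_act_def[of q, abs_def] laurent_monom_sum sum_distrib_left)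
  finally show ?thesis by (simp add: laurent_act_def[of p])
qed

lemma laurent_act_faithful:
  fixes p :: "((nat ^ 'n::finite) \<times> (nat ^ 'n)) \<Rightarrow>\<^sub>0 'k::field_char_0"
  assumes zero: "\<And>\<phi> m. laurent_act p \<phi> m = 0"
  shows "p = 0"
proof (rule ccontr)
  assume "p \<noteq> 0"
  then have ne: "Poly_Mapping.keys p \<noteq> {}" by simp
  define sz where "sz = (\<lambda>(a :: nat ^ 'n, b :: nat ^ 'n). \<Sum>i\<in>UNIV. b $ i)"
  obtain x where x: "x \<in> Poly_Mapping.keys p" and min: "\<And>y. y \<in> Poly_Mapping.keys p \<Longrightarrow> sz x \<le> sz y"
    using ex_min_if_finite[of "sz ` Poly_Mapping.keys p"] ne by (auto simp: not_less) 
  obtain a b where ab: "x = (a, b)" by force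
  define \<delta> where "\<delta> = (\<lambda>m. if m = vmap int b then 1 else 0 :: 'k)"
  have other: "laurent_monom y \<delta> (vmap int a) = 0" if y: "y \<in> Poly_Mapping.keys p" "y \<noteq> x" for y
  proof -
    obtain c e where ce: "y = (c, e)" by force
    show ?thesis
    proof (cases "vmap int a - vmap int c + vmap int e = vmap int b")
      case True
      have "\<exists>i. b $ i < e $ i"
      proof (rule ccontr)
        assume "\<not> ?thesis"
        then have le: "e $ i \<le> b $ i" for i by (auto simp: not_less)
        moreover have "(\<Sum>i\<in>UNIV. b $ i) \<le> (\<Sum>i\<in>UNIV. e $ i)"
          using min[OF y(1)] by (simp add: sz_def ab ce)
        ultimately have "e $ i = b $ i" for i
          using sum_mono_inv[of "\<lambda>i. e $ i" UNIV "\<lambda>i. b $ i" i] le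
          by (metis (no_types, lifting) UNIV_I finite_class.finite_UNIV le_antisym sum_mono)
        then have "e = b" by (simp add: vec_eq_iff)
        with True have "a = c" by (auto simp: vec_eq_iff vmap_def)
        with \<open>e = b\<close> y(2) show False by (simp add: ab ce)
      qed
      then obtain i where "b $ i < e $ i" ..
      then have "ffv (vmap int b) e = (0 :: 'k)"
        unfolding ffv_def vmap_def
        by (intro prod_zero) (auto simp: ff_nat binomial_eq_0 intro!: exI[of _ i])
      with True show ?thesis by (simp add: laurent_monom_def ce)
    qed (simp add: laurent_monom_def ce \<delta>_def)
  qed
  have "laurent_act p \<delta> (vmap int a) = Poly_Mapping.lookup p x * laurent_monom x \<delta> (vmap int a)"
    unfolding laurent_act_def using x other
    by (subst sum.remove[of _ x]) (auto intro!: sum.neutral)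
  moreover have "laurent_monom x \<delta> (vmap int a) \<noteq> 0"
    by (simp add: laurent_monom_def ab \<delta>_def ffv_def vmap_def ff_nat)
  ultimately show False using zero x by (simp add: in_keys_iff)
qed

lemma laurent_act_eqI:
  fixes p q :: "((nat ^ 'n::finite) \<times> (nat ^ 'n)) \<Rightarrow>\<^sub>0 'k::field_char_0"
  assumes "\<And>\<phi> m. laurent_act p \<phi> m = laurent_act q \<phi> m"
  shows "p = q"
proof -
  have "p + - q = 0"
    by (rule laurent_act_faithful) (simp only: laurent_act_add laurent_act_uminus assms right_minus)
  then show ?thesis by simp
qed

lemma laurent_monom_one [simp]: "laurent_monom (0, 0) \<phi> m = \<phi> m"
  by (simp add: laurent_monom_def vmap_def ffv_def ff_def zero_vec_def[symmetric])

instantiation weyl :: (field_char_0, finite) ring_1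
begin

lift_definition zero_weyl :: "('a, 'b) weyl" is 0 .
lift_definition one_weyl :: "('a, 'b) weyl" is "Poly_Mapping.single (0, 0) 1" .
lift_definition plus_weyl :: "('a, 'b) weyl \<Rightarrow> ('a, 'b) weyl \<Rightarrow> ('a, 'b) weyl" is "(+)" .
lift_definition minus_weyl :: "('a, 'b) weyl \<Rightarrow> ('a, 'b) weyl \<Rightarrow> ('a, 'b) weyl" is "(-)" .
lift_definition uminus_weyl :: "('a, 'b) weyl \<Rightarrow> ('a, 'b) weyl" is uminus .
lift_definition times_weyl :: "('a, 'b) weyl \<Rightarrow> ('a, 'b) weyl \<Rightarrow> ('a, 'b) weyl" is normal_times .

instance
proof
  fix P Q R :: "('a, 'b) weyl"
  show "P + Q + R = P + (Q + R)" by transfer (simp add: algebra_simps)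
  show "P + Q = Q + P" by transfer (simp add: algebra_simps)
  show "0 + P = P" by transfer simp
  show "- P + P = 0" by transfer simp
  show "P - Q = P + - Q" by transfer simp
  show "P * Q * R = P * (Q * R)"
    by transfer (rule laurent_act_eqI, simp add: laurent_act_times fun_eq_iff[symmetric]
        laurent_act_times[abs_def])
  show "(P + Q) * R = P * R + Q * R"
    by transfer (rule laurent_act_eqI, simp add: laurent_act_times laurent_act_add)
  show "P * (Q + R) = P * Q + P * R"
    by transfer (rule laurent_act_eqI,
        simp add: laurent_act_times laurent_act_add laurent_act_fun_add[symmetric]
          laurent_act_add[abs_def])
  show "1 * P = P"
    by transfer (rule laurent_act_eqI, simp add: laurent_act_times laurent_act_single)
  show "P * 1 = P"
    by transfer (rule laurent_act_eqI, simp add: laurent_act_times laurent_act_single[abs_def])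
  show "0 \<noteq> (1 :: ('a, 'b) weyl)"
    by transfer (metis lookup_single_eq lookup_zero zero_neq_one)
qed

end


text \<open>The operator $c\,x^a \partial^b$.\<close>

lift_definition weyl_monom ::
  "'k::field_char_0 \<Rightarrow> nat ^ 'n \<Rightarrow> nat ^ 'n \<Rightarrow> ('k, 'n::finite) weyl" is
  "\<lambda>c a b. Poly_Mapping.single (a, b) c" .

definition weyl_x :: "'n \<Rightarrow> ('k::field_char_0, 'n::finite) weyl" where
  "weyl_x j = weyl_monom 1 (axis j 1) 0"

definition weyl_d :: "'n \<Rightarrow> ('k::field_char_0, 'n::finite) weyl" where
  "weyl_d j = weyl_monom 1 0 (axis j 1)"

definition weyl_theta :: "'n \<Rightarrow> ('k::field_char_0, 'n::finite) weyl" where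
  "weyl_theta j = weyl_x j * weyl_d j"

lemma vmap_axis [simp]: "vmap int (axis j n) = axis j (int n)"
  by (simp add: vmap_def axis_def vec_eq_iff)

lemma vmap_zero [simp]: "vmap int 0 = 0"
  by (simp add: vmap_def vec_eq_iff)

lemma ffv_zero [simp]: "ffv z 0 = 1"
  by (simp add: ffv_def ff_def)

lemma axis_component: "axis i c $ j = (if j = i then c else 0)"
  by (auto simp: axis_def)

lemma ffv_axis [simp]: "ffv z (axis j (Suc 0)) = of_int (z $ j)"
proof -
  have "ffv z (axis j (Suc 0)) = (\<Prod>i\<in>UNIV. if i = j then of_int (z $ j) else 1 :: 'a)"
    unfolding ffv_def by (intro prod.cong) (auto simp: axis_def ff_def)
  then show ?thesis by simp
qed

lemma laurent_act_coeffs_times: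
  "laurent_act (weyl_coeffs (P * Q)) \<phi> m = laurent_act (weyl_coeffs P) (laurent_act (weyl_coeffs Q) \<phi>) m"
  by transfer (rule laurent_act_times)

lemma laurent_act_weyl_monom:
  "laurent_act (weyl_coeffs (weyl_monom c a b)) \<phi> = (\<lambda>m. c * laurent_monom (a, b) \<phi> m)"
  by transfer (simp add: laurent_act_single fun_eq_iff)

lemma weyl_eqI:
  fixes P Q :: "('k::field_char_0, 'n::finite) weyl"
  assumes "\<And>\<phi> m. laurent_act (weyl_coeffs P) \<phi> m = laurent_act (weyl_coeffs Q) \<phi> m"
  shows "P = Q"
  using laurent_act_eqI[OF assms] by (simp add: weyl_coeffs_inject)

lemma laurent_act_theta:
  "laurent_act (weyl_coeffs (weyl_theta j)) \<phi> = (\<lambda>m. of_int (m $ j) * \<phi> m)"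
  by (simp add: weyl_theta_def weyl_x_def weyl_d_def laurent_act_coeffs_times
      laurent_act_weyl_monom laurent_monom_def fun_eq_iff)

lemma weyl_monom_one: "weyl_monom 1 0 0 = 1"
  by transfer simp

lemma weyl_monom_const_mult: "weyl_monom c 0 0 * weyl_monom c' a b = weyl_monom (c * c') a b"
  by (rule weyl_eqI)
     (simp add: laurent_act_coeffs_times laurent_act_weyl_monom laurent_monom_def algebra_simps)

lemma weyl_monom_normal_form: "weyl_monom c a b = weyl_monom c a 0 * weyl_monom 1 0 b"
  by (rule weyl_eqI)
     (simp add: laurent_act_coeffs_times laurent_act_weyl_monom laurent_monom_def algebra_simps)

lemma weyl_x_commute: "weyl_x i * weyl_x j = weyl_x j * weyl_x i"
  by (rule weyl_eqI)
     (simp add: laurent_act_coeffs_times laurent_act_weyl_monom laurent_monom_def weyl_x_def algebra_simps)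

lemma weyl_d_commute: "weyl_d i * weyl_d j = weyl_d j * weyl_d i"
  by (rule weyl_eqI)
     (simp add: laurent_act_coeffs_times laurent_act_weyl_monom laurent_monom_def weyl_d_def
       algebra_simps axis_component)

lemma weyl_d_x: "weyl_d i * weyl_x j = weyl_x j * weyl_d i + (if i = j then 1 else 0)"
proof -
  have add: "weyl_coeffs (P + Q) = weyl_coeffs P + weyl_coeffs Q" for P Q :: "('a, 'b) weyl"
    by transfer simp
  have one: "laurent_act (weyl_coeffs (1 :: ('a, 'b) weyl)) \<phi> = \<phi>" for \<phi>
    by transfer (simp add: laurent_act_single fun_eq_iff)
  have zero: "weyl_coeffs (0 :: ('a, 'b) weyl) = 0"
    by transfer simp
  show ?thesis
    by (rule weyl_eqI)
       (simp add: add one zero laurent_act_coeffs_times laurent_act_weyl_monom laurent_act_add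
         laurent_monom_def weyl_d_def weyl_x_def algebra_simps axis_component)
qed

lemma weyl_theta_commute: "weyl_theta i * weyl_theta j = weyl_theta j * weyl_theta i"
  by (rule weyl_eqI) (simp add: laurent_act_coeffs_times laurent_act_theta mult.left_commute)

text \<open>Substitution of the $\partial_j$, respectively the $\theta_j$, into a commutative polynomial.\<close>

definition subst_d :: "('k, 'n) mpoly \<Rightarrow> ('k::field_char_0, 'n::finite) weyl" where
  "subst_d p = (\<Sum>b\<in>Poly_Mapping.keys p. weyl_monom (Poly_Mapping.lookup p b) 0 b)"

definition subst_theta :: "('k, 'n) mpoly \<Rightarrow> ('k::field_char_0, 'n::finite) weyl" where
  "subst_theta p = (\<Sum>m\<in>Poly_Mapping.keys p. weyl_monom (Poly_Mapping.lookup p m) 0 0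
     * Finite_Set.fold (\<lambda>j P. weyl_theta j ^ (m $ j) * P) 1 UNIV)"

lemma comp_fun_commute_theta: "comp_fun_commute (\<lambda>j P. weyl_theta j ^ (f j) * P)"
proof
  fix i j
  have "weyl_theta i ^ f i * weyl_theta j ^ f j = weyl_theta j ^ f j * (weyl_theta i ^ f i :: ('b, 'a) weyl)"
    by (metis power_commuting_commutes weyl_theta_commute)
  then show "(\<lambda>P. weyl_theta j ^ f j * P) \<circ> (\<lambda>P. weyl_theta i ^ f i * P)
      = (\<lambda>P. weyl_theta i ^ f i * P) \<circ> (\<lambda>P. weyl_theta j ^ f j * (P :: ('b, 'a) weyl))"
    by (simp add: fun_eq_iff flip: mult.assoc)
qed

section \<open>Hypergeometric ideals and their initial ideals\<close>

definition kernel_lattice :: "int ^ 'n ^ 'd \<Rightarrow> (int ^ 'n::finite) set" where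
  "kernel_lattice A = {u. A *v u = 0}"

definition toric_ideal :: "int ^ 'n ^ 'd \<Rightarrow> ('k::field_char_0, 'n::finite) mpoly set" where
  "toric_ideal A = left_ideal hull
     {Poly_Mapping.single u 1 - Poly_Mapping.single v 1 | u v. A *v vmap int u = A *v vmap int v}"

definition hypergeometric_ideal ::
  "int ^ 'n ^ 'd \<Rightarrow> 'k ^ 'd \<Rightarrow> ('k::field_char_0, 'n::finite) weyl set" where
  "hypergeometric_ideal A \<beta> = left_ideal hull
     (subst_d ` toric_ideal A
      \<union> range (\<lambda>i. (\<Sum>j\<in>UNIV. of_int (A $ i $ j) * weyl_theta j) - weyl_monom (\<beta> $ i) 0 0))"

definition initial_ideal ::
  "real ^ 'n \<Rightarrow> ('k::field_char_0, 'n::finite) mpoly set \<Rightarrow> ('k, 'n) mpoly set" where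
  "initial_ideal w I = left_ideal hull (initial_form (\<lambda>b. w \<bullet> vmap real b) ` I)"

text \<open>The weights are \<open>- w\<close> for the $x_j$ and \<open>w\<close> for the $\partial_j$.\<close>

definition weyl_initial_ideal ::
  "real ^ 'n \<Rightarrow> ('k::field_char_0, 'n::finite) weyl set \<Rightarrow> ('k, 'n) weyl set" where
  "weyl_initial_ideal w J = left_ideal hull
     ((\<lambda>P. Weyl (initial_form (\<lambda>(a, b). - w \<bullet> vmap real a + w \<bullet> vmap real b) (weyl_coeffs P))) ` J)"

definition generic_weight ::
  "int ^ 'n ^ 'd \<Rightarrow> 'k::field_char_0 ^ 'd \<Rightarrow> real ^ 'n::finite \<Rightarrow> bool" where
  "generic_weight A \<beta> w \<longleftrightarrow> (\<forall>\<^sub>F w' in nhds w.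
     initial_ideal w' (toric_ideal A :: ('k, 'n) mpoly set) = initial_ideal w (toric_ideal A) \<and>
     weyl_initial_ideal w' (hypergeometric_ideal A \<beta>) = weyl_initial_ideal w (hypergeometric_ideal A \<beta>))"

definition homogeneous_columns :: "int ^ 'n ^ 'd \<Rightarrow> bool" where
  "homogeneous_columns A \<longleftrightarrow>
     (\<exists>(h :: rat ^ 'd) c. h \<noteq> 0 \<and> c \<noteq> 0 \<and> (\<forall>j. (\<Sum>i\<in>UNIV. h $ i * of_int (A $ i $ j)) = c))"

section \<open>Regular triangulations\<close>

definition real_column :: "int ^ 'n ^ 'd \<Rightarrow> 'n \<Rightarrow> real ^ 'd" where
  "real_column A j = vmap real_of_int (column j A)"

definition conv_columns :: "int ^ 'n ^ 'd \<Rightarrow> (real ^ 'd) set" where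
  "conv_columns A = convex hull (range (real_column A))"

definition regular_triangulation :: "int ^ 'n ^ 'd \<Rightarrow> real ^ 'n \<Rightarrow> (real ^ 'd) set set" where
  "regular_triangulation A w = insert {}
     {convex hull (real_column A ` I) | I.
        \<exists>c. (\<forall>j\<in>I. c \<bullet> real_column A j = w $ j) \<and> (\<forall>j. j \<notin> I \<longrightarrow> c \<bullet> real_column A j < w $ j)}"

section \<open>Fake exponents, logarithmic series and exponents\<close>

definition fake_indicial_ideal ::
  "int ^ 'n ^ 'd \<Rightarrow> 'k ^ 'd \<Rightarrow> real ^ 'n \<Rightarrow> ('k::field_char_0, 'n::finite) mpoly set" where
  "fake_indicial_ideal A \<beta> w = left_ideal hull
     ({f. subst_theta f \<in> left_ideal hull (subst_d ` initial_ideal w (toric_ideal A))}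
      \<union> range (\<lambda>i. (\<Sum>j\<in>UNIV. Poly_Mapping.single (axis j 1) (of_int (A $ i $ j)))
                     - Poly_Mapping.single 0 (\<beta> $ i)))"

definition fake_exponent ::
  "int ^ 'n ^ 'd \<Rightarrow> 'k ^ 'd \<Rightarrow> real ^ 'n \<Rightarrow> 'k::field_char_0 ^ 'n::finite \<Rightarrow> bool" where
  "fake_exponent A \<beta> w v \<longleftrightarrow> (\<forall>f\<in>fake_indicial_ideal A \<beta> w. mpoly_eval v f = 0)"

text \<open>For fixed \<open>v\<close>, the family \<open>g\<close> stands for the formal series
  $\sum_{u \in \mathbf{Z}^n} g_u(\log x)\, x^{v+u}$, where $g_u$ is a polynomial in
  $y_j = \log x_j$. On $x^{v+u} g(\log x)$ the operator $\partial_j$ acts by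
  $x^{v+u-e_j} ((v_j + u_j) g + \partial g / \partial y_j)(\log x)$.\<close>

type_synonym ('k, 'n) log_series = "int ^ 'n \<Rightarrow> ('k, 'n) mpoly"

definition log_x_power ::
  "nat ^ 'n \<Rightarrow> ('k::field_char_0, 'n::finite) log_series \<Rightarrow> ('k, 'n) log_series" where
  "log_x_power a g = (\<lambda>u. g (u - vmap int a))"

definition log_d ::
  "'k ^ 'n \<Rightarrow> 'n \<Rightarrow> ('k::field_char_0, 'n::finite) log_series \<Rightarrow> ('k, 'n) log_series" where
  "log_d v j g = (\<lambda>u. mpoly_scale (v $ j + of_int (u $ j + 1)) (g (u + axis j 1))
                       + mpoly_pderiv j (g (u + axis j 1)))"

definition log_d_power ::
  "'k ^ 'n \<Rightarrow> nat ^ 'n \<Rightarrow> ('k::field_char_0, 'n::finite) log_series \<Rightarrow> ('k, 'n) log_series" where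
  "log_d_power v b g = Finite_Set.fold (\<lambda>j. log_d v j ^^ (b $ j)) g UNIV"

definition log_act ::
  "'k ^ 'n \<Rightarrow> ('k::field_char_0, 'n::finite) weyl \<Rightarrow> ('k, 'n) log_series \<Rightarrow> ('k, 'n) log_series" where
  "log_act v P g = (\<lambda>u. \<Sum>(a, b)\<in>Poly_Mapping.keys (weyl_coeffs P).
     mpoly_scale (Poly_Mapping.lookup (weyl_coeffs P) (a, b)) (log_x_power a (log_d_power v b g) u))"

lemma lookup_mpoly_scale: "Poly_Mapping.lookup (mpoly_scale c p) m = c * Poly_Mapping.lookup p m"
  by (simp add: mpoly_scale_def Poly_Mapping.map.rep_eq when_def)

lemma lookup_mpoly_pderiv:
  "Poly_Mapping.lookup (mpoly_pderiv j p) m = of_nat (m $ j + 1) * Poly_Mapping.lookup p (m + axis j 1)"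
proof -
  have eq: "Poly_Mapping.lookup (Poly_Mapping.single (m' - axis j 1) (of_nat (m' $ j) * Poly_Mapping.lookup p m')) m
      = (if m' = m + axis j 1 then of_nat (m $ j + 1) * Poly_Mapping.lookup p m' else 0)" for m'
  proof (cases "m' $ j = 0")
    case True
    then have "m' \<noteq> m + axis j 1" by (auto simp: axis_def)
    with True show ?thesis by simp
  next
    case False
    then have "m' - axis j 1 = m \<longleftrightarrow> m' = m + axis j 1"
      by (auto simp: vec_eq_iff axis_def)
    then show ?thesis by (auto simp: lookup_single when_def axis_def)
  qed
  show ?thesis
    unfolding mpoly_pderiv_def lookup_sum eq
    by (simp add: sum.delta in_keys_iff)
qed

lemma log_d_commute: "log_d v i (log_d v j g) = log_d v j (log_d v i g)"
proof (cases "i = j")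
  case False
  show ?thesis
  proof (intro ext poly_mapping_eqI)
    fix u m
    show "Poly_Mapping.lookup (log_d v i (log_d v j g) u) m = Poly_Mapping.lookup (log_d v j (log_d v i g) u) m"
      using False
      by (simp add: log_d_def lookup_add lookup_mpoly_scale lookup_mpoly_pderiv axis_def algebra_simps)
  qed
qed simp

lemma log_d_x:
  "log_d v i (log_x_power (axis j 1) g) u
   = log_x_power (axis j 1) (log_d v i g) u + (if i = j then g u else 0)"
proof (rule poly_mapping_eqI)
  fix m
  show "Poly_Mapping.lookup (log_d v i (log_x_power (axis j 1) g) u) m
    = Poly_Mapping.lookup (log_x_power (axis j 1) (log_d v i g) u + (if i = j then g u else 0)) m"
    by (simp add: log_d_def log_x_power_def lookup_add lookup_mpoly_scale lookup_mpoly_pderiv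
        axis_component algebra_simps)
qed

lemma comp_fun_commute_log_d: "comp_fun_commute (\<lambda>j. log_d v j ^^ (b j))"
proof
  fix i j
  have 1: "(log_d v i ^^ n) (log_d v j g) = log_d v j ((log_d v i ^^ n) g)" for n g
    by (induction n) (simp_all add: log_d_commute[of v i j])
  have "(log_d v i ^^ n) ((log_d v j ^^ m) g) = (log_d v j ^^ m) ((log_d v i ^^ n) g)" for n m g
    by (induction m) (simp_all add: 1)
  then show "log_d v j ^^ b j \<circ> log_d v i ^^ b i = log_d v i ^^ b i \<circ> log_d v j ^^ b j"
    by (simp add: fun_eq_iff)
qed

definition hypergeometric_series ::
  "int ^ 'n ^ 'd \<Rightarrow> 'k ^ 'd \<Rightarrow> 'k ^ 'n \<Rightarrow> ('k::field_char_0, 'n::finite) log_series \<Rightarrow> bool" where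
  "hypergeometric_series A \<beta> v g \<longleftrightarrow>
     (\<forall>u. u \<notin> kernel_lattice A \<longrightarrow> g u = 0) \<and>
     (\<forall>P\<in>hypergeometric_ideal A \<beta>. log_act v P g = (\<lambda>_. 0))"

definition in_direction :: "real ^ 'n \<Rightarrow> ('k::field_char_0, 'n::finite) log_series \<Rightarrow> bool" where
  "in_direction w g \<longleftrightarrow> (\<exists>B :: (rat ^ 'n) set.
     vec.independent B \<and> vec.span B = UNIV \<and> (\<forall>b\<in>B. w \<bullet> vmap of_rat b > 0) \<and>
     (\<forall>u. \<not> (\<exists>c. (\<forall>b\<in>B. 0 \<le> c b) \<and> vmap of_int u = (\<Sum>b\<in>B. c b *s b)) \<longrightarrow> g u = 0))"

definition exponent ::
  "int ^ 'n ^ 'd \<Rightarrow> 'k ^ 'd \<Rightarrow> real ^ 'n \<Rightarrow> 'k::field_char_0 ^ 'n::finite \<Rightarrow> bool" where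
  "exponent A \<beta> w v \<longleftrightarrow> fake_exponent A \<beta> w v \<and>
     (\<exists>g. hypergeometric_series A \<beta> v g \<and> g 0 \<noteq> 0 \<and> in_direction w g)"

definition nsupp :: "'k::field_char_0 ^ 'n \<Rightarrow> 'n set" where
  "nsupp v = {i. \<exists>z::int. z < 0 \<and> v $ i = of_int z}"

definition minimal_negative_support :: "int ^ 'n ^ 'd \<Rightarrow> 'k::field_char_0 ^ 'n::finite \<Rightarrow> bool" where
  "minimal_negative_support A v \<longleftrightarrow>
     \<not> (\<exists>u\<in>kernel_lattice A. nsupp (v + vmap of_int u) \<subset> nsupp v)"

end

theory Submission
  imports Defs
begin

text \<open>Suppose that $\varphi = \sum_u g_u(\log x)\, x^{v+u}$ is an $A$-hypergeometric series in the
  direction of $w$ with $g_0 \neq 0$. The proof shows that $\varphi$ contains no logarithms, and that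
  a series without logarithms forces $v$ to have minimal negative support.

  Let $I$ index the vertices of the simplex $\mathrm{conv}(A)$, so that the $a_i$ with $i \in I$ are
  linearly independent. For $j \notin I$ some positive multiple of $a_j$ is a nonnegative integer
  combination of them: $M a_j = \sum_{i \in I} n_i a_i$ (\<open>dual_rows\<close>, \<open>column_relation\<close>). The vector
  $b = M e_j - n \in L$ is nonzero, and $w \cdot b \ge 0$ because the single maximal cell of the
  triangulation is all of $\mathrm{conv}(A)$. For large $k$ the vector $u - k b$ therefore leaves the
  simplicial cone that supports $\varphi$ (\<open>in_direction_eventually_vanishes\<close>), and the equation
  $\partial_j^{kM} \varphi = \partial^{kn} \varphi$ gives $\partial_j^{kM} (g_u(\log x)\, x^{v+u}) = 0$.
  On a single term $\partial_j^{kM}$ is a product of operators $c + \partial/\partial y_j$ with distinct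
  $c$, hence $\partial g_u/\partial y_j = 0$ (\<open>log_x_derivative_vanishes\<close>). The Euler equations and the
  independence of the $a_i$ extend this to all $j$
  (\<open>Euler_equations_imp_derivatives_vanish\<close>), so every $g_u$ is a constant.

  Now let $u \in L$ satisfy $\mathrm{nsupp}(v+u) \subsetneq \mathrm{nsupp}(v)$, and write
  $u = u_+ - u_-$. Some coordinate of $v$ is a negative integer that $u$ makes nonnegative, so
  $\partial^{u_+}$ kills the constant multiple $g_u x^{v+u}$. No coordinate crosses zero in the other direction, so
  $\partial^{u_-}$ is injective on multiples of $x^v$. As $\partial^{u_+} \varphi = \partial^{u_-} \varphi$,
  this gives $g_0 = 0$, a contradiction (\<open>log_free_series_minimal_negative_support\<close>).\<close>

section \<open>Logarithmic coefficients\<close>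

lemma mpoly_scale_zero [simp]: "mpoly_scale c 0 = 0"
  by (rule poly_mapping_eqI) (simp add: lookup_mpoly_scale)

lemma mpoly_scale_zero_left [simp]: "mpoly_scale 0 p = 0"
  by (rule poly_mapping_eqI) (simp add: lookup_mpoly_scale)

lemma mpoly_scale_one [simp]: "mpoly_scale 1 p = p"
  by (rule poly_mapping_eqI) (simp add: lookup_mpoly_scale)

lemma mpoly_pderiv_zero [simp]: "mpoly_pderiv j 0 = 0"
  by (rule poly_mapping_eqI) (simp add: lookup_mpoly_pderiv)

text \<open>A nonzero scalar plus a constant-coefficient derivation is injective, because the derivation
  lowers the degree.\<close>

lemma scale_plus_derivation_eq_0_iff:
  fixes p :: "('k::field_char_0, 'n::finite) mpoly"
  assumes "c \<noteq> 0"
  shows "mpoly_scale c p + (\<Sum>j\<in>UNIV. mpoly_scale (\<alpha> j) (mpoly_pderiv j p)) = 0 \<longleftrightarrow> p = 0"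
proof
  assume eq: "mpoly_scale c p + (\<Sum>j\<in>UNIV. mpoly_scale (\<alpha> j) (mpoly_pderiv j p)) = 0"
  show "p = 0"
  proof (rule ccontr)
    assume "p \<noteq> 0"
    then have "Poly_Mapping.keys p \<noteq> {}" by simp
    moreover define deg where "deg m = (\<Sum>i\<in>UNIV. m $ i)" for m :: "nat ^ 'n"
    ultimately have "Max (deg ` Poly_Mapping.keys p) \<in> deg ` Poly_Mapping.keys p"
      by (intro Max_in) auto
    then obtain m where m: "m \<in> Poly_Mapping.keys p" and "deg m = Max (deg ` Poly_Mapping.keys p)"
      by auto
    then have max: "deg m' \<le> deg m" if "m' \<in> Poly_Mapping.keys p" for m'
      using that by simp
    have "deg (m + axis j 1) = deg m + 1" for j
      by (simp add: deg_def sum.distrib axis_component)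
    then have "Poly_Mapping.lookup p (m + axis j 1) = 0" for j
      using max[of "m + axis j 1"] by (force simp: in_keys_iff)
    then have "c * Poly_Mapping.lookup p m = 0"
      using arg_cong[OF eq, of "\<lambda>q. Poly_Mapping.lookup q m"]
      by (simp add: lookup_add lookup_sum lookup_mpoly_scale lookup_mpoly_pderiv)
    with assms m show False by (simp add: in_keys_iff)
  qed
qed simp

text \<open>The operator \<open>c + \<partial>/\<partial>y\<^sub>j\<close>: up to the shift of the exponent, this is the action of $\partial_j$ on
  $x^s p(\log x)$ with $s_j = c$.\<close>

definition shifted_deriv :: "'n \<Rightarrow> 'k \<Rightarrow> ('k::field_char_0, 'n::finite) mpoly \<Rightarrow> ('k, 'n) mpoly" where
  "shifted_deriv j c p = mpoly_scale c p + mpoly_pderiv j p"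

lemma shifted_deriv_zero [simp]: "shifted_deriv j c 0 = 0"
  by (simp add: shifted_deriv_def)

lemma shifted_deriv_eq_0_iff:
  assumes "c \<noteq> 0"
  shows "shifted_deriv j c p = 0 \<longleftrightarrow> p = 0"
proof -
  have "(\<Sum>i\<in>UNIV. mpoly_scale (if i = j then 1 else 0) (mpoly_pderiv i p)) = mpoly_pderiv j p"
    by (rule poly_mapping_eqI)
       (simp add: lookup_sum lookup_mpoly_scale if_distrib[of "\<lambda>x. x * _"] cong: if_cong)
  with scale_plus_derivation_eq_0_iff[OF assms, of p "\<lambda>i. if i = j then 1 else 0"]
  show ?thesis by (simp add: shifted_deriv_def)
qed

lemma mpoly_pderiv_shifted_deriv:
  "mpoly_pderiv i (shifted_deriv j c p) = shifted_deriv j c (mpoly_pderiv i p)"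
  by (rule poly_mapping_eqI)
     (simp add: shifted_deriv_def lookup_add lookup_mpoly_scale lookup_mpoly_pderiv
       axis_component algebra_simps)

text \<open>The composite of the operators \<open>(c + k) + \<partial>/\<partial>y\<^sub>j\<close> for \<open>1 \<le> k \<le> n\<close>, which describes $\partial_j^n$
  on terms whose exponent at \<open>j\<close> is \<open>c + n\<close>.\<close>

primrec shifted_deriv_prod ::
  "'n \<Rightarrow> 'k \<Rightarrow> nat \<Rightarrow> ('k::field_char_0, 'n::finite) mpoly \<Rightarrow> ('k, 'n) mpoly" where
  "shifted_deriv_prod j c 0 p = p"
| "shifted_deriv_prod j c (Suc n) p = shifted_deriv j (c + of_nat (Suc n)) (shifted_deriv_prod j c n p)"

lemma shifted_deriv_prod_zero [simp]: "shifted_deriv_prod j c n 0 = 0"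
  by (induction n) auto

lemma mpoly_pderiv_shifted_deriv_prod:
  "mpoly_pderiv i (shifted_deriv_prod j c n p) = shifted_deriv_prod j c n (mpoly_pderiv i p)"
  by (induction n) (auto simp: mpoly_pderiv_shifted_deriv)

lemma shifted_deriv_prod_injective:
  assumes "shifted_deriv_prod j c n p = 0" "\<And>k. 1 \<le> k \<Longrightarrow> k \<le> n \<Longrightarrow> c + of_nat k \<noteq> 0"
  shows "p = 0"
  using assms
proof (induction n)
  case (Suc n)
  from Suc.prems(2)[of "Suc n"] Suc.prems(1) have "shifted_deriv_prod j c n p = 0"
    by (simp add: shifted_deriv_eq_0_iff)
  with Suc show ?case by (meson le_SucI)
qed simp

text \<open>At most one factor is not injective, and that factor is \<open>\<partial>/\<partial>y\<^sub>j\<close> itself.\<close>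

lemma shifted_deriv_prod_eq_0_imp_pderiv:
  fixes p :: "('k::field_char_0, 'n::finite) mpoly"
  assumes "shifted_deriv_prod j c n p = 0"
  shows "mpoly_pderiv j p = 0"
  using assms
proof (induction n)
  case (Suc n)
  show ?case
  proof (cases "c + of_nat (Suc n) = 0")
    case True
    then have "shifted_deriv_prod j c n (mpoly_pderiv j p) = 0"
      using Suc.prems
      by (simp add: shifted_deriv_def mpoly_pderiv_shifted_deriv_prod poly_mapping_eq_iff
          lookup_add fun_eq_iff lookup_mpoly_scale)
    moreover have "c + of_nat k \<noteq> 0" if "k \<le> n" for k
    proof
      assume "c + of_nat k = 0"
      with True have "of_nat (Suc n) = (of_nat k :: 'k)" by (metis add_left_cancel)
      with that show False by (simp only: of_nat_eq_iff)
    qed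
    ultimately show ?thesis by (blast intro: shifted_deriv_prod_injective)
  next
    case False
    with Suc show ?thesis by (simp add: shifted_deriv_eq_0_iff)
  qed
qed simp

lemma shifted_deriv_prod_annihilates:
  assumes "mpoly_pderiv j p = 0" "1 \<le> k" "k \<le> n" "c + of_nat k = 0"
  shows "shifted_deriv_prod j c n p = 0"
  using assms(3)
proof (induction n)
  case (Suc n)
  show ?case
  proof (cases "k = Suc n")
    case True
    with assms(1,4) show ?thesis
      by (simp add: shifted_deriv_def mpoly_pderiv_shifted_deriv_prod)
  next
    case False
    with Suc show ?thesis by simp
  qed
qed (use assms(2) in simp)

section \<open>Powers of derivations on logarithmic series\<close>

lemma log_d_iterate:
  fixes g :: "('k::field_char_0, 'n::finite) log_series"
  shows
  "(log_d v j ^^ n) g u = shifted_deriv_prod j (v $ j + of_int (u $ j)) n (g (u + axis j (int n)))"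
proof (induction n arbitrary: g)
  case 0
  have "u + axis j (int 0) = u" by (simp add: vec_eq_iff axis_component)
  then show ?case by (simp only: funpow_0 shifted_deriv_prod.simps)
next
  case (Suc n)
  have 1: "u + axis j (int n) + axis j 1 = u + axis j (int (Suc n))"
    by (simp add: vec_eq_iff axis_component)
  have "(log_d v j ^^ Suc n) g u = (log_d v j ^^ n) (log_d v j g) u"
    by (simp add: funpow_swap1)
  also have "\<dots> = shifted_deriv_prod j (v $ j + of_int (u $ j)) n
      (shifted_deriv j (v $ j + of_int (u $ j) + of_nat (Suc n)) (g (u + axis j (int (Suc n)))))"
    unfolding Suc by (simp only: log_d_def 1) (simp add: shifted_deriv_def axis_component add_ac)
  also have "\<dots> = shifted_deriv_prod j (v $ j + of_int (u $ j)) (Suc n) (g (u + axis j (int (Suc n))))"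
  proof -
    have comm: "shifted_deriv j a (shifted_deriv j b p) = shifted_deriv j b (shifted_deriv j a p)" for a b p
      by (rule poly_mapping_eqI)
         (simp add: shifted_deriv_def lookup_add lookup_mpoly_scale lookup_mpoly_pderiv algebra_simps)
    have "shifted_deriv_prod j b n (shifted_deriv j a p) = shifted_deriv j a (shifted_deriv_prod j b n p)" for a b p
      by (induction n) (auto simp: comm[of a])
    then show ?thesis by simp
  qed
  finally show ?case .
qed

text \<open>The factor $\prod_{j \in S} \partial_j^{b_j}$ of $\partial^b$, acting on a series. Its properties
  are proved by induction on \<open>S\<close>.\<close>

definition log_d_partial ::
  "'k ^ 'n \<Rightarrow> nat ^ 'n \<Rightarrow> ('k::field_char_0, 'n::finite) log_series \<Rightarrow> 'n set \<Rightarrow> ('k, 'n) log_series" where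
  "log_d_partial v b g S = Finite_Set.fold (\<lambda>j. log_d v j ^^ (b $ j)) g S"

lemma log_d_partial_empty: "log_d_partial v b g {} = g"
  by (simp add: log_d_partial_def)

lemma log_d_partial_insert:
  assumes "j \<notin> S"
  shows "log_d_partial v b g (insert j S) u
    = shifted_deriv_prod j (v $ j + of_int (u $ j)) (b $ j) (log_d_partial v b g S (u + axis j (int (b $ j))))"
proof -
  interpret comp_fun_commute "\<lambda>j. log_d v j ^^ (b $ j)" by (rule comp_fun_commute_log_d)
  show ?thesis using assms by (simp add: log_d_partial_def log_d_iterate)
qed

text \<open>The exponent \<open>b\<close> with its coordinates outside \<open>S\<close> replaced by zero.\<close>

definition restrict_exponent :: "nat ^ 'n \<Rightarrow> 'n set \<Rightarrow> int ^ 'n" where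
  "restrict_exponent b S = (\<chi> i. if i \<in> S then int (b $ i) else 0)"

lemma restrict_exponent_insert:
  "j \<notin> S \<Longrightarrow> u + restrict_exponent b (insert j S) = u + axis j (int (b $ j)) + restrict_exponent b S"
  by (auto simp: restrict_exponent_def vec_eq_iff axis_component)

lemma restrict_exponent_empty [simp]: "restrict_exponent b {} = 0"
  by (auto simp: restrict_exponent_def vec_eq_iff)

lemma restrict_exponent_UNIV: "restrict_exponent b UNIV = vmap int b"
  by (auto simp: restrict_exponent_def vec_eq_iff vmap_def)

lemma log_d_power_partial: "log_d_power v b g = log_d_partial v b g UNIV"
  by (simp add: log_d_power_def log_d_partial_def)

text \<open>In the next three lemmas the coefficient of $\partial^b$ applied to the series \<open>g\<close> is read off at
  position \<open>u\<close>; it comes from the single coefficient of \<open>g\<close> at \<open>u + b\<close>, through factors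
  $v_i + u_i + k + \partial/\partial y_i$ with $1 \le k \le b_i$.\<close>

lemma log_d_power_local:
  assumes "g (u + vmap int b) = 0"
  shows "log_d_power v b g u = 0"
proof -
  have "log_d_partial v b g S u = 0" if "finite S" "g (u + restrict_exponent b S) = 0" for S
    using that
  proof (induction S arbitrary: u)
    case (insert j S)
    then show ?case by (simp add: log_d_partial_insert restrict_exponent_insert)
  qed (simp add: log_d_partial_empty)
  from this[of UNIV] assms show ?thesis by (simp add: log_d_power_partial restrict_exponent_UNIV)
qed

lemma log_d_power_injective:
  assumes "log_d_power v b g u = 0"
    and "\<And>i k. 1 \<le> k \<Longrightarrow> k \<le> b $ i \<Longrightarrow> v $ i + of_int (u $ i) + of_nat k \<noteq> 0"
  shows "g (u + vmap int b) = 0"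
proof -
  have "g (u + restrict_exponent b S) = 0"
    if "finite S" "log_d_partial v b g S u = 0"
       "\<And>i k. i \<in> S \<Longrightarrow> 1 \<le> k \<Longrightarrow> k \<le> b $ i \<Longrightarrow> v $ i + of_int (u $ i) + of_nat k \<noteq> 0" for S
    using that
  proof (induction S arbitrary: u)
    case (insert j S)
    have "log_d_partial v b g S (u + axis j (int (b $ j))) = 0"
    proof (rule shifted_deriv_prod_injective)
      show "shifted_deriv_prod j (v $ j + of_int (u $ j)) (b $ j)
          (log_d_partial v b g S (u + axis j (int (b $ j)))) = 0"
        using insert.prems(1) insert.hyps(2) by (simp add: log_d_partial_insert)
    qed (use insert.prems(2) in auto)
    moreover have "v $ i + of_int ((u + axis j (int (b $ j))) $ i) + of_nat k \<noteq> 0"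
      if "i \<in> S" "1 \<le> k" "k \<le> b $ i" for i k
    proof -
      have "i \<noteq> j" using that insert.hyps by auto
      then show ?thesis using insert.prems(2)[of i k] that by (simp add: axis_component)
    qed
    ultimately show ?case using insert.IH insert.hyps by (simp add: restrict_exponent_insert)
  qed (simp add: log_d_partial_empty)
  from this[of UNIV] assms show ?thesis by (simp add: log_d_power_partial restrict_exponent_UNIV)
qed

lemma log_d_power_annihilates:
  assumes "mpoly_pderiv i (g (u + vmap int b)) = 0"
    and "1 \<le> k" "k \<le> b $ i" "v $ i + of_int (u $ i) + of_nat k = 0"
  shows "log_d_power v b g u = 0"
proof -
  have pd: "mpoly_pderiv i (log_d_partial v b g S u) = 0"
    if "finite S" "mpoly_pderiv i (g (u + restrict_exponent b S)) = 0" for S u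
    using that
  proof (induction S arbitrary: u)
    case (insert j S)
    then show ?case
      by (simp add: log_d_partial_insert restrict_exponent_insert mpoly_pderiv_shifted_deriv_prod)
  qed (simp add: log_d_partial_empty)
  define S where "S = UNIV - {i}"
  have S: "i \<notin> S" "insert i S = UNIV" by (auto simp: S_def)
  have "mpoly_pderiv i (log_d_partial v b g S (u + axis i (int (b $ i)))) = 0"
    using assms(1) S restrict_exponent_insert[of i S u b]
    by (intro pd) (simp_all add: restrict_exponent_UNIV add.assoc)
  then have "log_d_partial v b g (insert i S) u = 0"
    unfolding log_d_partial_insert[OF S(1)] using assms by (intro shifted_deriv_prod_annihilates) auto
  with S show ?thesis by (simp add: log_d_power_partial)
qed

lemma log_d_power_axis: "log_d_power v (axis j n) g = (log_d v j ^^ n) g"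
proof -
  interpret comp_fun_commute "\<lambda>i. log_d v i ^^ (axis j n $ i)" by (rule comp_fun_commute_log_d)
  let ?F = "\<lambda>S. Finite_Set.fold (\<lambda>i. log_d v i ^^ (axis j n $ i)) g S"
  have "?F S = g" if "finite S" "j \<notin> S" for S
    using that
  proof (induction S)
    case (insert x S)
    have "?F (insert x S) = (log_d v x ^^ (axis j n $ x)) (?F S)"
      by (rule fold_insert) (use insert in auto)
    moreover have "x \<noteq> j" using insert.prems by blast
    ultimately show ?case using insert by (simp add: axis_component)
  qed simp
  moreover have "?F (insert j (UNIV - {j})) = (log_d v j ^^ (axis j n $ j)) (?F (UNIV - {j}))"
    by (rule fold_insert) auto
  ultimately show ?thesis by (simp add: log_d_power_def insert_absorb)
qed

section \<open>The toric and Euler equations\<close>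

lemma log_act_superset:
  fixes P :: "('k::field_char_0, 'n::finite) weyl"
  assumes "finite S" "Poly_Mapping.keys (weyl_coeffs P) \<subseteq> S"
  shows "log_act v P g u = (\<Sum>(a, b)\<in>S.
     mpoly_scale (Poly_Mapping.lookup (weyl_coeffs P) (a, b)) (log_x_power a (log_d_power v b g) u))"
  unfolding log_act_def
  by (rule sum.mono_neutral_left[OF assms]) (auto simp: in_keys_iff)

lemma log_act_add:
  fixes P Q :: "('k::field_char_0, 'n::finite) weyl"
  shows "log_act v (P + Q) g u = log_act v P g u + log_act v Q g u"
proof -
  let ?S = "Poly_Mapping.keys (weyl_coeffs P) \<union> Poly_Mapping.keys (weyl_coeffs Q)"
  have [simp]: "weyl_coeffs (P + Q) = weyl_coeffs P + weyl_coeffs Q" by transfer simp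
  have "Poly_Mapping.keys (weyl_coeffs (P + Q)) \<subseteq> ?S" by (simp add: Poly_Mapping.keys_add)
  moreover have "mpoly_scale (c + d) q = mpoly_scale c q + mpoly_scale d q" for c d and q :: "('k, 'n) mpoly"
    by (rule poly_mapping_eqI) (simp add: lookup_mpoly_scale lookup_add algebra_simps)
  ultimately show ?thesis
    by (simp add: log_act_superset[of ?S] lookup_add split_def sum.distrib)
qed

lemma log_act_zero [simp]: "log_act v 0 g u = 0"
  using log_act_add[of v 0 0 g u] by simp

lemma log_act_uminus: "log_act v (- P) g u = - log_act v P g u"
  using log_act_add[of v "- P" P g u] by (simp add: eq_neg_iff_add_eq_0)

lemma log_act_diff: "log_act v (P - Q) g u = log_act v P g u - log_act v Q g u"
  using log_act_add[of v P "- Q" g u] by (simp add: log_act_uminus)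

lemma log_act_sum: "log_act v (\<Sum>i\<in>I. P i) g u = (\<Sum>i\<in>I. log_act v (P i) g u)"
  by (induction I rule: infinite_finite_induct) (auto simp: log_act_add)

lemma log_act_of_int_mult: "log_act v (of_int z * P) g u = mpoly_scale (of_int z) (log_act v P g u)"
proof (rule poly_mapping_eqI)
  show "Poly_Mapping.lookup (log_act v (of_int z * P) g u) m
      = Poly_Mapping.lookup (mpoly_scale (of_int z) (log_act v P g u)) m" for m
    by (induction z rule: int_induct[of _ 0])
       (auto simp: lookup_mpoly_scale log_act_add log_act_diff lookup_add lookup_minus algebra_simps)
qed

lemma log_act_weyl_monom:
  "log_act v (weyl_monom c a b) g u = mpoly_scale c (log_d_power v b g (u - vmap int a))"
proof -
  have [simp]: "weyl_coeffs (weyl_monom c a b) = Poly_Mapping.single (a, b) c" by transfer simp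
  show ?thesis by (simp add: log_act_superset[of "{(a, b)}"] log_x_power_def)
qed

lemma weyl_theta_eq: "weyl_theta j = weyl_monom 1 (axis j 1) (axis j 1)"
  by (simp add: weyl_theta_def weyl_x_def weyl_d_def flip: weyl_monom_normal_form)

lemma log_act_theta:
  "log_act v (weyl_theta j) g u = mpoly_scale (v $ j + of_int (u $ j)) (g u) + mpoly_pderiv j (g u)"
  by (simp add: weyl_theta_eq log_act_weyl_monom log_d_power_axis log_d_def axis_component)

text \<open>The relation $\partial^p \varphi = \partial^q \varphi$ for a hypergeometric series $\varphi$.\<close>

lemma toric_equation:
  fixes A :: "int ^ 'n::finite ^ 'd" and g :: "('k::field_char_0, 'n) log_series"
  assumes "hypergeometric_series A \<beta> v g" "A *v vmap int p = A *v vmap int q"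
  shows "log_d_power v p g u = log_d_power v q g u"
proof (cases "p = q")
  case False
  define f :: "('k, 'n) mpoly" where "f = Poly_Mapping.single p 1 - Poly_Mapping.single q 1"
  have lk: "Poly_Mapping.lookup f m = (if m = p then 1 else if m = q then -1 else 0)" for m
    using False by (auto simp: f_def lookup_minus lookup_single when_def)
  have "Poly_Mapping.keys f = {p, q}" by (auto simp: in_keys_iff lk split: if_splits)
  then have s: "subst_d f = weyl_monom 1 0 p + weyl_monom (-1) 0 q"
    using False by (simp add: subst_d_def lk)
  have "f \<in> toric_ideal A"
    unfolding toric_ideal_def f_def using assms(2) by (intro hull_inc) auto
  then have "subst_d f \<in> hypergeometric_ideal A \<beta>"
    unfolding hypergeometric_ideal_def by (intro hull_inc) auto
  with assms(1) have "log_act v (subst_d f) g u = 0"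
    by (simp add: hypergeometric_series_def)
  moreover have "mpoly_scale (-1) x = - x" for x :: "('k, 'n) mpoly"
    by (rule poly_mapping_eqI) (simp add: lookup_mpoly_scale)
  ultimately show ?thesis by (simp add: s log_act_add log_act_weyl_monom)
qed simp

text \<open>On $x^{v+u} g_u(\log x)$ the \<open>i\<close>-th Euler operator acts as $(Av - \beta)_i$ plus the derivation
  $\sum_j a_{ij}\, \partial/\partial y_j$, because $Au = 0$.\<close>

lemma Euler_equation:
  fixes A :: "int ^ 'n::finite ^ 'd" and g :: "('k::field_char_0, 'n) log_series"
  assumes "hypergeometric_series A \<beta> v g" "u \<in> kernel_lattice A"
  shows "mpoly_scale ((\<Sum>j\<in>UNIV. of_int (A $ i $ j) * v $ j) - \<beta> $ i) (g u)
    + (\<Sum>j\<in>UNIV. mpoly_scale (of_int (A $ i $ j)) (mpoly_pderiv j (g u))) = 0"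
proof -
  let ?P = "(\<Sum>j\<in>UNIV. of_int (A $ i $ j) * weyl_theta j) - weyl_monom (\<beta> $ i) 0 0"
  have "?P \<in> hypergeometric_ideal A \<beta>"
    unfolding hypergeometric_ideal_def by (intro hull_inc) auto
  with assms(1) have 0: "log_act v ?P g u = 0"
    by (simp add: hypergeometric_series_def)
  have "log_d_power v 0 g = g"
  proof -
    have "axis i 0 = (0 :: nat ^ 'n)" for i :: 'n by (simp add: vec_eq_iff axis_component)
    then show ?thesis using log_d_power_axis[of v undefined 0 g] by (simp only: funpow_0)
  qed
  with 0 have 1: "(\<Sum>j\<in>UNIV. mpoly_scale (of_int (A $ i $ j))
      (mpoly_scale (v $ j + of_int (u $ j)) (g u) + mpoly_pderiv j (g u))) - mpoly_scale (\<beta> $ i) (g u) = 0"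
    by (simp add: log_act_diff log_act_sum log_act_of_int_mult log_act_theta log_act_weyl_monom)
  have "(\<Sum>j\<in>UNIV. A $ i $ j * u $ j) = (A *v u) $ i"
    by (simp add: matrix_vector_mult_def)
  also have "\<dots> = 0" using assms(2) by (simp add: kernel_lattice_def)
  finally have "(\<Sum>j\<in>UNIV. of_int (A $ i $ j) * of_int (u $ j)) = (0 :: 'k)"
    by (metis (mono_tags, lifting) of_int_0 of_int_mult of_int_sum sum.cong)
  note Au = this
  show ?thesis
  proof (rule poly_mapping_eqI)
    fix m
    let ?l = "\<lambda>p :: ('k, 'n) mpoly. Poly_Mapping.lookup p m"
    have "0 = (\<Sum>j\<in>UNIV. of_int (A $ i $ j) * ((v $ j + of_int (u $ j)) * ?l (g u) + ?l (mpoly_pderiv j (g u))))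
        - \<beta> $ i * ?l (g u)"
      using arg_cong[OF 1, of ?l] by (simp add: lookup_minus lookup_sum lookup_mpoly_scale lookup_add)
    also have "\<dots> = (\<Sum>j\<in>UNIV. of_int (A $ i $ j) * v $ j) * ?l (g u)
        + (\<Sum>j\<in>UNIV. of_int (A $ i $ j) * of_int (u $ j)) * ?l (g u)
        + (\<Sum>j\<in>UNIV. of_int (A $ i $ j) * ?l (mpoly_pderiv j (g u))) - \<beta> $ i * ?l (g u)"
      by (simp add: distrib_left distrib_right sum.distrib sum_distrib_right mult.assoc)
    finally have "0 = (\<Sum>j\<in>UNIV. of_int (A $ i $ j) * v $ j) * ?l (g u)
        + (\<Sum>j\<in>UNIV. of_int (A $ i $ j) * ?l (mpoly_pderiv j (g u))) - \<beta> $ i * ?l (g u)"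
      by (simp only: Au mult_zero_left add_0_right)
    then show "?l (mpoly_scale ((\<Sum>j\<in>UNIV. of_int (A $ i $ j) * v $ j) - \<beta> $ i) (g u)
      + (\<Sum>j\<in>UNIV. mpoly_scale (of_int (A $ i $ j)) (mpoly_pderiv j (g u)))) = ?l 0"
      by (simp add: lookup_add lookup_sum lookup_mpoly_scale algebra_simps)
  qed
qed


text \<open>If the series vanishes somewhere on the ray from \<open>u\<close> in the direction $-(N e_j - n)$, with
  $N e_j - n \in L$ and $n \in \mathbf{N}^n$, then a power of $\partial_j$ kills its term at \<open>u\<close>.\<close>

lemma log_x_derivative_vanishes:
  fixes A :: "int ^ 'n::finite ^ 'd" and g :: "('k::field_char_0, 'n) log_series"
  assumes series: "hypergeometric_series A \<beta> v g"
    and rel: "A *v axis j (int N) = A *v vmap int n"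
    and vanish: "\<exists>k. g (u - int k *s (axis j (int N) - vmap int n)) = 0"
  shows "mpoly_pderiv j (g u) = 0"
proof -
  from vanish obtain k where k: "g (u - int k *s (axis j (int N) - vmap int n)) = 0" ..
  define p where "p = axis j (k * N)"
  define q where "q = (\<chi> i. k * n $ i)"
  have vp: "vmap int p = int k *s axis j (int N)"
    by (simp add: p_def vec_eq_iff axis_component)
  have vq: "vmap int q = int k *s vmap int n"
    by (simp add: q_def vec_eq_iff vmap_def)
  have scale: "A *v (int k *s y) = int k *s (A *v y)" for y
    by (simp add: matrix_vector_mult_def vec_eq_iff sum_distrib_left mult.left_commute)
  have "A *v vmap int p = A *v vmap int q"
    by (simp add: vp vq scale rel)
  then have "log_d_power v p g (u - vmap int p) = log_d_power v q g (u - vmap int p)"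
    by (rule toric_equation[OF series])
  also have "\<dots> = 0"
  proof (rule log_d_power_local)
    have "u - vmap int p + vmap int q = u - int k *s (axis j (int N) - vmap int n)"
      by (simp add: vp vq vec_eq_iff algebra_simps)
    with k show "g (u - vmap int p + vmap int q) = 0" by (simp only:)
  qed
  finally have "shifted_deriv_prod j (v $ j + of_int ((u - vmap int p) $ j)) (k * N)
      (g (u - vmap int p + axis j (int (k * N)))) = 0"
    by (simp only: p_def log_d_power_axis log_d_iterate)
  then have "mpoly_pderiv j (g (u - vmap int p + axis j (int (k * N)))) = 0"
    by (rule shifted_deriv_prod_eq_0_imp_pderiv)
  then show ?thesis by (simp add: p_def)
qed

section \<open>Support in a simplicial cone\<close>

lemma inner_vmap_of_rat_sum:
  fixes w :: "real ^ 'n::finite"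
  shows "w \<bullet> vmap of_rat (\<Sum>b\<in>B. c b *s b) = (\<Sum>b\<in>B. of_rat (c b) * (w \<bullet> vmap of_rat b))"
proof -
  have "w \<bullet> vmap of_rat (\<Sum>b\<in>B. c b *s b) = (\<Sum>i\<in>UNIV. \<Sum>b\<in>B. w $ i * (of_rat (c b) * of_rat (b $ i)))"
    by (simp add: inner_vec_def vmap_def of_rat_sum of_rat_mult sum_distrib_left)
  also have "\<dots> = (\<Sum>b\<in>B. \<Sum>i\<in>UNIV. w $ i * (of_rat (c b) * of_rat (b $ i)))"
    by (rule sum.swap)
  finally show ?thesis by (simp add: inner_vec_def vmap_def sum_distrib_left mult.left_commute)
qed

text \<open>A ray in direction \<open>- b\<close> leaves the simplicial cone: some coordinate of \<open>b\<close> in the basis of the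
  cone is positive, for otherwise $w \cdot b \ge 0$ and positivity of \<open>w\<close> on the basis force \<open>b = 0\<close>.
  The case $w \cdot b = 0$ is included.\<close>

lemma in_direction_eventually_vanishes:
  fixes g :: "('k::field_char_0, 'n::finite) log_series"
  assumes dir: "in_direction w g" and "b \<noteq> 0" and nonneg: "0 \<le> w \<bullet> vmap real_of_int b"
  shows "\<exists>k. g (u - int k *s b) = 0"
proof (rule ccontr)
  assume never: "\<nexists>k. g (u - int k *s b) = 0"
  obtain B :: "(rat ^ 'n) set" where B: "vec.independent B" "vec.span B = UNIV"
    and pos: "\<And>b. b \<in> B \<Longrightarrow> w \<bullet> vmap of_rat b > 0"
    and supp: "\<And>u. g u \<noteq> 0 \<Longrightarrow> \<exists>c. (\<forall>b\<in>B. 0 \<le> c b) \<and> vmap of_int u = (\<Sum>b\<in>B. c b *s b)"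
    using dir unfolding in_direction_def by blast
  have fin: "finite B" using B(1) by (rule vec.finiteI_independent)
  let ?q = "vmap rat_of_int"
  let ?r = "vec.representation B"
  have sum_repr: "(\<Sum>x\<in>B. ?r y x *s x) = y" for y
    by (rule vec.sum_representation_eq) (use B fin in auto)
  have repr_sum: "?r (\<Sum>x\<in>B. c x *s x) x = c x" if "x \<in> B" for c x
  proof -
    have "?r (\<Sum>y\<in>B. c y *s y) x = (\<Sum>y\<in>B. c y * ?r y x)"
      using B by (simp add: vec.representation_sum vec.representation_scale)
    also have "\<dots> = (\<Sum>y\<in>B. if y = x then c y else 0)"
      using B(1) by (intro sum.cong) (auto simp: vec.representation_basis)
    finally show ?thesis using that fin by simp
  qed
  have nonpos: "?r (?q b) x \<le> 0" if x: "x \<in> B" for x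
  proof (rule ccontr)
    assume "\<not> ?thesis"
    then have p: "?r (?q b) x > 0" by simp
    obtain k :: nat where k: "?r (?q u) x < of_nat k * ?r (?q b) x"
      using reals_Archimedean3[OF p] by blast
    have "?q (u - int k *s b) = ?q u - of_nat k *s ?q b"
      by (simp add: vec_eq_iff vmap_def)
    then have "?r (?q (u - int k *s b)) x = ?r (?q u) x - of_nat k * ?r (?q b) x"
      using B by (simp add: vec.representation_diff vec.representation_scale)
    moreover have "?r (?q (u - int k *s b)) x \<ge> 0"
      using supp[of "u - int k *s b"] never repr_sum[OF x] x by force
    ultimately show False using k by simp
  qed
  have "vmap of_rat (?q b) = vmap real_of_int b" by (simp add: vec_eq_iff vmap_def)
  then have eq: "w \<bullet> vmap real_of_int b = (\<Sum>x\<in>B. of_rat (?r (?q b) x) * (w \<bullet> vmap of_rat x))"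
    using inner_vmap_of_rat_sum[of w "?r (?q b)" B] by (simp add: sum_repr)
  define t where "t x = - of_rat (?r (?q b) x) * (w \<bullet> vmap of_rat x)" for x
  have t: "0 \<le> t x" if "x \<in> B" for x
    using nonpos[OF that] pos[OF that] by (simp add: t_def mult_nonpos_nonneg)
  have "sum t B = - (w \<bullet> vmap real_of_int b)"
    unfolding eq by (simp add: t_def sum_negf)
  with nonneg t have "sum t B = 0"
    using sum_nonneg[of B t] by simp
  then have "\<forall>x\<in>B. t x = 0" using sum_nonneg_eq_0_iff[OF fin t] by simp
  then have "?r (?q b) x = 0" if "x \<in> B" for x
    using pos[OF that] that unfolding t_def by fastforce
  then have "?q b = 0" using sum_repr[of "?q b"] by simp
  with \<open>b \<noteq> 0\<close> show False by (simp add: vec_eq_iff vmap_def)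
qed

section \<open>The vertices of the simplex\<close>

lemma common_denominator:
  fixes S :: "rat set"
  assumes "finite S"
  shows "\<exists>M::int. M > 0 \<and> (\<forall>q\<in>S. of_int M * q \<in> \<int>)"
  using assms
proof (induction S)
  case empty
  show ?case by (intro exI[of _ 1]) auto
next
  case (insert q S)
  then obtain M :: int where M: "M > 0" "\<forall>q\<in>S. of_int M * q \<in> \<int>" by blast
  obtain a b where ab: "quotient_of q = (a, b)" by force
  then have "b > 0" "q = of_int a / of_int b"
    by (simp_all add: quotient_of_denom_pos quotient_of_div)
  then have "of_int (b * M) * q = of_int (M * a)" by simp
  moreover have "of_int (b * M) * x = of_int b * (of_int M * x)" for x :: rat by simp
  ultimately have "\<forall>x\<in>insert q S. of_int (b * M) * x \<in> \<int>"
    using M(2) by (metis Ints_mult Ints_of_int insert_iff)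
  with \<open>b > 0\<close> M(1) show ?case by (intro exI[of _ "b * M"]) simp
qed

text \<open>A common integer multiple of a dual basis for linearly independent columns.\<close>

lemma dual_rows:
  fixes A :: "int ^ 'n::finite ^ 'd"
  assumes inj: "inj_on (\<lambda>i. vmap rat_of_int (column i A)) I"
    and indep: "vec.independent ((\<lambda>i. vmap rat_of_int (column i A)) ` I)"
  obtains M :: int and l :: "'n \<Rightarrow> int ^ 'd" where "M > 0"
    "\<And>i j. i \<in> I \<Longrightarrow> j \<in> I \<Longrightarrow> (\<Sum>r\<in>UNIV. l i $ r * A $ r $ j) = (if i = j then M else 0)"
proof -
  let ?c = "\<lambda>i. vmap rat_of_int (column i A)"
  have "\<exists>q :: rat ^ 'd. \<forall>j\<in>I. (\<Sum>r\<in>UNIV. q $ r * of_int (A $ r $ j)) = (if i = j then 1 else 0)"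
    if "i \<in> I" for i
  proof -
    obtain f where f: "Vector_Spaces.linear (*s) (*s) f"
      "\<forall>x\<in>?c ` I. f x = (if x = ?c i then axis undefined 1 else (0 :: rat ^ 'd))"
      using vec.linear_independent_extend[OF indep, of "\<lambda>x. if x = ?c i then axis undefined 1 else 0"] by blast
    have "(\<Sum>r\<in>UNIV. (matrix f $ undefined) $ r * of_int (A $ r $ j)) = (if i = j then 1 else 0)"
      if "j \<in> I" for j
    proof -
      have "(\<Sum>r\<in>UNIV. (matrix f $ undefined) $ r * of_int (A $ r $ j)) = (matrix f *v ?c j) $ undefined"
        by (simp add: matrix_vector_mult_def vmap_def column_def)
      also have "\<dots> = f (?c j) $ undefined" by (simp add: matrix_works[OF f(1)])
      also have "\<dots> = (if ?c j = ?c i then 1 else 0)"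
        using f(2) that by (auto simp: axis_component)
      finally show ?thesis using inj_onD[OF inj _ \<open>j \<in> I\<close> \<open>i \<in> I\<close>] by auto
    qed
    then show ?thesis by blast
  qed
  then obtain q :: "'n \<Rightarrow> rat ^ 'd" where q: "\<And>i j. i \<in> I \<Longrightarrow> j \<in> I \<Longrightarrow>
      (\<Sum>r\<in>UNIV. q i $ r * of_int (A $ r $ j)) = (if i = j then 1 else 0)"
    by metis
  obtain M :: int where M: "M > 0" "\<forall>x\<in>range (\<lambda>(i, r). q i $ r). of_int M * x \<in> \<int>"
    using common_denominator[of "range (\<lambda>(i, r). q i $ r)"] by auto
  define l where "l i = (\<chi> r. \<lfloor>of_int M * q i $ r\<rfloor>)" for i
  have l: "of_int (l i $ r) = of_int M * q i $ r" for i r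
    using M(2) by (auto simp: l_def)
  have "(\<Sum>r\<in>UNIV. l i $ r * A $ r $ j) = (if i = j then M else 0)" if "i \<in> I" "j \<in> I" for i j
  proof -
    have "rat_of_int (\<Sum>r\<in>UNIV. l i $ r * A $ r $ j) = of_int M * (\<Sum>r\<in>UNIV. q i $ r * of_int (A $ r $ j))"
      by (simp add: l sum_distrib_left mult.assoc)
    also have "\<dots> = of_int (if i = j then M else 0)" by (simp add: q that)
    finally show ?thesis by (simp only: of_int_eq_iff)
  qed
  with M(1) show thesis using that by blast
qed

lemma real_column_nth [simp]: "real_column A j $ r = of_int (A $ r $ j)"
  by (simp add: real_column_def vmap_def column_def)

text \<open>The index set of a cell of the triangulation may contain columns that are not vertices of
  the cell, and repeated columns; \<open>I\<close> selects exactly one index for each vertex. The inequality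
  $c \cdot a_j \le w_j$ therefore need not be strict for \<open>j\<close> outside \<open>I\<close>.\<close>

lemma simplex_triangulation_vertices:
  fixes A :: "int ^ 'n::finite ^ 'd"
  assumes "r simplex conv_columns A"
    and "regular_triangulation A w = {F. F face_of conv_columns A}"
  obtains I c where "\<And>j. c \<bullet> real_column A j \<le> w $ j" "\<And>j. j \<in> I \<Longrightarrow> c \<bullet> real_column A j = w $ j"
    "inj_on (real_column A) I" "\<not> affine_dependent (real_column A ` I)"
    "conv_columns A = convex hull (real_column A ` I)"
proof -
  let ?a = "real_column A"
  obtain C where C: "\<not> affine_dependent C" "conv_columns A = convex hull C"
    using assms(1) by (auto simp: simplex_def)
  have "conv_columns A face_of conv_columns A"
    by (simp add: conv_columns_def face_of_refl)
  then have "conv_columns A \<in> regular_triangulation A w" by (simp add: assms(2))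
  moreover have "conv_columns A \<noteq> {}" by (simp add: conv_columns_def)
  ultimately obtain J c where J: "conv_columns A = convex hull (?a ` J)"
      "\<forall>j\<in>J. c \<bullet> ?a j = w $ j" "\<forall>j. j \<notin> J \<longrightarrow> c \<bullet> ?a j < w $ j"
    by (auto simp: regular_triangulation_def)
  have "C \<subseteq> ?a ` J"
  proof
    fix x assume "x \<in> C"
    then have "x extreme_point_of (convex hull C)"
      using C(1) by (simp add: extreme_point_of_convex_hull_affine_independent)
    then have "x extreme_point_of (convex hull (?a ` J))"
      using C(2) J(1) by simp
    then show "x \<in> ?a ` J" by (rule extreme_point_of_convex_hull)
  qed
  then obtain I where I: "I \<subseteq> J" "inj_on ?a I" "C = ?a ` I"
    by (meson subset_image_inj)
  show thesis
  proof (rule that[of c I])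
    show "c \<bullet> ?a j \<le> w $ j" for j using J(2,3) by (cases "j \<in> J") (auto simp: less_imp_le)
    show "c \<bullet> ?a j = w $ j" if "j \<in> I" for j using J(2) I(1) that by auto
  qed (use I C in auto)
qed

text \<open>The columns lie on a hyperplane that misses the origin, so a linear relation between them has
  coefficient sum zero and is an affine relation.\<close>

lemma affine_independent_columns_imp_independent:
  fixes A :: "int ^ 'n::finite ^ 'd"
  assumes hom: "homogeneous_columns A"
    and inj: "inj_on (real_column A) I" and aff: "\<not> affine_dependent (real_column A ` I)"
  shows "inj_on (\<lambda>i. vmap rat_of_int (column i A)) I"
    and "vec.independent ((\<lambda>i. vmap rat_of_int (column i A)) ` I)"
proof -
  let ?c = "\<lambda>i. vmap rat_of_int (column i A)" and ?a = "real_column A"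
  show inj': "inj_on ?c I"
    using inj by (auto simp: inj_on_def vec_eq_iff vmap_def column_def)
  show "vec.independent (?c ` I)"
  proof
    assume "vec.dependent (?c ` I)"
    then obtain q where q0: "(\<Sum>x\<in>?c ` I. q x *s x) = 0" and "\<exists>x\<in>?c ` I. q x \<noteq> 0"
      by (subst (asm) vec.dependent_finite) auto
    then obtain i0 where i0: "i0 \<in> I" "q (?c i0) \<noteq> 0" by auto
    have "(\<Sum>i\<in>I. q (?c i) *s ?c i) = 0"
      using q0 by (simp add: sum.reindex[OF inj'])
    then have comp: "(\<Sum>i\<in>I. q (?c i) * of_int (A $ r $ i)) = 0" for r
      by (simp add: vec_eq_iff vmap_def column_def)
    obtain h :: "rat ^ 'd" and c where h: "c \<noteq> 0" "\<And>j. (\<Sum>r\<in>UNIV. h $ r * of_int (A $ r $ j)) = c"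
      using hom by (auto simp: homogeneous_columns_def)
    have "c * (\<Sum>i\<in>I. q (?c i)) = (\<Sum>i\<in>I. \<Sum>r\<in>UNIV. h $ r * (q (?c i) * of_int (A $ r $ i)))"
      unfolding sum_distrib_left
    proof (rule sum.cong[OF refl])
      fix i
      show "c * q (?c i) = (\<Sum>r\<in>UNIV. h $ r * (q (?c i) * of_int (A $ r $ i)))"
        unfolding h(2)[of i, symmetric] sum_distrib_right by (simp add: mult_ac)
    qed
    also have "\<dots> = (\<Sum>r\<in>UNIV. h $ r * (\<Sum>i\<in>I. q (?c i) * of_int (A $ r $ i)))"
      by (subst sum.swap) (simp add: sum_distrib_left)
    finally have sum0: "(\<Sum>i\<in>I. q (?c i)) = 0" using comp h(1) by simp
    define U where "U y = real_of_rat (q (?c (inv_into I ?a y)))" for y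
    have U: "U (?a i) = of_rat (q (?c i))" if "i \<in> I" for i
      using inj that by (simp add: U_def)
    have "sum U (?a ` I) = 0"
      using sum0 by (simp add: sum.reindex[OF inj] U flip: of_rat_sum)
    moreover have "(\<Sum>y\<in>?a ` I. U y *\<^sub>R y) = 0"
    proof -
      have "(\<Sum>i\<in>I. of_rat (q (?c i)) * of_int (A $ r $ i)) = (0 :: real)" for r
        using arg_cong[OF comp[of r], of real_of_rat] by (simp add: of_rat_sum of_rat_mult)
      then show ?thesis
        by (simp add: sum.reindex[OF inj] U vec_eq_iff)
    qed
    ultimately have "affine_dependent (?a ` I)"
      using i0 U[OF i0(1)] by (subst affine_dependent_explicit_finite) (auto intro!: exI[of _ U] bexI[of _ i0])
    with aff show False ..
  qed
qed

text \<open>The barycentric coordinates of $a_j$ become integers after multiplication by \<open>M\<close>, since the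
  dual rows compute them.\<close>

lemma column_relation:
  fixes A :: "int ^ 'n::finite ^ 'd"
  assumes dual: "\<And>i j. i \<in> I \<Longrightarrow> j \<in> I \<Longrightarrow> (\<Sum>r\<in>UNIV. l i $ r * A $ r $ j) = (if i = j then M else 0)"
    and M: "M > 0" and hull: "real_column A j \<in> convex hull (real_column A ` I)"
    and inj: "inj_on (real_column A) I"
  obtains n where "A *v axis j M = A *v vmap int n" "\<And>i. i \<notin> I \<Longrightarrow> n $ i = 0"
proof -
  let ?a = "real_column A"
  obtain f where f: "\<forall>x\<in>?a ` I. 0 \<le> f x" "(\<Sum>x\<in>?a ` I. f x *\<^sub>R x) = ?a j"
    using hull by (subst (asm) convex_hull_finite) auto
  define t where "t i = f (?a i)" for i
  have t0: "0 \<le> t i" if "i \<in> I" for i using f(1) that by (simp add: t_def)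
  have "(\<Sum>i\<in>I. t i *\<^sub>R ?a i) = ?a j"
    using f(2) by (simp add: sum.reindex[OF inj] t_def)
  then have t: "(\<Sum>i\<in>I. t i * of_int (A $ r $ i)) = of_int (A $ r $ j)" for r
    by (simp add: vec_eq_iff)
  define z where "z i = (\<Sum>r\<in>UNIV. l i $ r * A $ r $ j)" for i
  have z: "of_int (z i) = of_int M * t i" if "i \<in> I" for i
  proof -
    have "real_of_int (z i) = (\<Sum>r\<in>UNIV. of_int (l i $ r) * (\<Sum>k\<in>I. t k * of_int (A $ r $ k)))"
      by (simp add: z_def t)
    also have "\<dots> = (\<Sum>k\<in>I. t k * of_int (\<Sum>r\<in>UNIV. l i $ r * A $ r $ k))"
      by (simp add: sum_distrib_left mult_ac) (rule sum.swap)
    also have "\<dots> = (\<Sum>k\<in>I. if i = k then t k * of_int M else 0)"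
      using that by (intro sum.cong refl) (simp add: dual)
    finally show ?thesis using that by (simp add: mult.commute)
  qed
  define n where "n = (\<chi> i. if i \<in> I then nat (z i) else 0)"
  have zn: "z i \<ge> 0" if "i \<in> I" for i
    using z[OF that] t0[OF that] M by (metis mult_nonneg_nonneg of_int_0_le_iff less_imp_le)
  show thesis
  proof (rule that[of n])
    have "M * A $ r $ j = (\<Sum>i\<in>I. z i * A $ r $ i)" for r
    proof -
      have "real_of_int (M * A $ r $ j) = of_int M * (\<Sum>i\<in>I. t i * of_int (A $ r $ i))"
        by (simp add: t)
      also have "\<dots> = of_int (\<Sum>i\<in>I. z i * A $ r $ i)"
        by (simp add: sum_distrib_left z mult.assoc)
      finally show ?thesis by (simp only: of_int_eq_iff)
    qed
    moreover have "(\<Sum>i\<in>UNIV. A $ r $ i * int (n $ i)) = (\<Sum>i\<in>I. z i * A $ r $ i)" for r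
      by (rule sum.mono_neutral_cong_right) (auto simp: n_def zn mult.commute)
    moreover have "(\<Sum>i\<in>UNIV. A $ r $ i * axis j M $ i) = M * A $ r $ j" for r
      by (simp add: axis_component if_distrib[of "\<lambda>x. _ * x"] mult.commute cong: if_cong)
    ultimately show "A *v axis j M = A *v vmap int n"
      by (simp add: matrix_vector_mult_def vec_eq_iff vmap_def)
  qed (simp add: n_def)
qed


section \<open>Hypergeometric series without logarithms\<close>

text \<open>If $Av \neq \beta$, the Euler equations force $g_u = 0$; otherwise the combination of them with
  the dual row of $a_i$ isolates $\partial g_u/\partial y_i$.\<close>

lemma Euler_equations_imp_derivatives_vanish:
  fixes A :: "int ^ 'n::finite ^ 'd" and g :: "('k::field_char_0, 'n) log_series"
  assumes dual: "\<And>i j. i \<in> I \<Longrightarrow> j \<in> I \<Longrightarrow> (\<Sum>r\<in>UNIV. l i $ r * A $ r $ j) = (if i = j then M else 0)"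
    and M: "M > 0" and series: "hypergeometric_series A \<beta> v g"
    and off: "\<And>j. j \<notin> I \<Longrightarrow> mpoly_pderiv j (g u) = 0"
  shows "mpoly_pderiv i (g u) = 0"
proof (cases "i \<in> I \<and> u \<in> kernel_lattice A")
  case True
  then have i: "i \<in> I" and u: "u \<in> kernel_lattice A" by auto
  let ?\<gamma> = "\<lambda>r. (\<Sum>j\<in>UNIV. of_int (A $ r $ j) * v $ j) - \<beta> $ r"
  note Euler = Euler_equation[OF series u]
  show ?thesis
  proof (cases "\<exists>r. ?\<gamma> r \<noteq> 0")
    case True
    then obtain r where "?\<gamma> r \<noteq> 0" ..
    then have "g u = 0" by (rule iffD1[OF scale_plus_derivation_eq_0_iff]) (rule Euler)
    then show ?thesis by simp
  next
    case False
    then have E: "(\<Sum>j\<in>UNIV. mpoly_scale (of_int (A $ r $ j)) (mpoly_pderiv j (g u))) = 0" for r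
      using Euler[of r] by simp
    show ?thesis
    proof (rule poly_mapping_eqI)
      fix m
      define P where "P j = Poly_Mapping.lookup (mpoly_pderiv j (g u)) m" for j
      have E': "(\<Sum>j\<in>UNIV. of_int (A $ r $ j) * P j) = 0" for r
        using arg_cong[OF E[of r], of "\<lambda>p. Poly_Mapping.lookup p m"]
        by (simp add: lookup_sum lookup_mpoly_scale P_def)
      have "0 = (\<Sum>r\<in>UNIV. of_int (l i $ r) * (\<Sum>j\<in>UNIV. of_int (A $ r $ j) * P j))"
        by (simp add: E')
      also have "\<dots> = (\<Sum>j\<in>UNIV. of_int (\<Sum>r\<in>UNIV. l i $ r * A $ r $ j) * P j)"
        by (simp add: sum_distrib_left sum_distrib_right mult.assoc) (rule sum.swap)
      also have "\<dots> = (\<Sum>j\<in>UNIV. if i = j then of_int M * P j else 0)"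
      proof (rule sum.cong[OF refl])
        fix j
        show "of_int (\<Sum>r\<in>UNIV. l i $ r * A $ r $ j) * P j = (if i = j then of_int M * P j else 0)"
        proof (cases "j \<in> I")
          case True
          then show ?thesis using dual[OF i True] by simp
        next
          case False
          then show ?thesis using off[OF False] i by (simp add: P_def)
        qed
      qed
      finally have "of_int M * P i = 0" by simp
      with M show "Poly_Mapping.lookup (mpoly_pderiv i (g u)) m = Poly_Mapping.lookup 0 m"
        by (simp add: P_def)
    qed
  qed
next
  case False
  with off[of i] series show ?thesis by (auto simp: hypergeometric_series_def)
qed

lemma log_free_series_minimal_negative_support:
  fixes A :: "int ^ 'n::finite ^ 'd" and g :: "('k::field_char_0, 'n) log_series"
  assumes series: "hypergeometric_series A \<beta> v g"
    and log_free: "\<And>i u. mpoly_pderiv i (g u) = 0" and "g 0 \<noteq> 0"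
  shows "minimal_negative_support A v"
  unfolding minimal_negative_support_def
proof
  assume "\<exists>u\<in>kernel_lattice A. nsupp (v + vmap of_int u) \<subset> nsupp v"
  then obtain u i where u: "A *v u = 0" and sub: "nsupp (v + vmap of_int u) \<subseteq> nsupp v"
    and i: "i \<in> nsupp v" "i \<notin> nsupp (v + vmap of_int u)"
    by (auto simp: kernel_lattice_def)
  have nsupp_iff: "j \<in> nsupp (v + vmap of_int u) \<longleftrightarrow> (\<exists>z<0. v $ j + of_int (u $ j) = of_int z)" for j
    by (simp add: nsupp_def vmap_def)
  \<comment> \<open>the positive and negative parts of \<open>u\<close>; both sides of the toric equation are read off at \<open>- q\<close>,
     where they involve the coefficients at \<open>u\<close> and at \<open>0\<close>\<close>
  define p where "p = vmap nat u"
  define q where "q = vmap (\<lambda>x. nat (- x)) u"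
  have pq: "vmap int p = u + vmap int q"
    by (simp add: p_def q_def vec_eq_iff vmap_def)
  have "A *v vmap int p = A *v vmap int q"
    unfolding pq by (simp add: matrix_vector_right_distrib u)
  then have "log_d_power v q g (- vmap int q) = log_d_power v p g (- vmap int q)"
    by (intro toric_equation[OF series]) (rule sym)
  also have "\<dots> = 0"
  proof -
    obtain z where z: "z < 0" "v $ i = of_int z" using i(1) by (auto simp: nsupp_def)
    have "\<not> z + u $ i < 0"
    proof
      assume "z + u $ i < 0"
      with z(2) have "i \<in> nsupp (v + vmap of_int u)"
        unfolding nsupp_iff by (intro exI[of _ "z + u $ i"]) simp
      with i(2) show False ..
    qed
    then have "q $ i = 0" "nat (- z) \<le> p $ i" using z(1) by (auto simp: p_def q_def vmap_def)
    \<comment> \<open>the factor with $k = -z$ is the one at which coordinate \<open>i\<close> crosses zero\<close>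
    with z show ?thesis
      by (intro log_d_power_annihilates[where i = i and k = "nat (- z)"] log_free)
         (auto simp: vmap_def)
  qed
  finally have "g (- vmap int q + vmap int q) = 0"
  proof (rule log_d_power_injective)
    \<comment> \<open>a vanishing factor would make \<open>v $ j\<close> a nonnegative integer with \<open>v $ j + u $ j\<close> negative\<close>
    fix j k assume k: "1 \<le> k" "k \<le> q $ j"
    show "v $ j + of_int ((- vmap int q) $ j) + of_nat k \<noteq> 0"
    proof
      assume "v $ j + of_int ((- vmap int q) $ j) + of_nat k = 0"
      moreover have "v $ j = (v $ j + of_int ((- vmap int q) $ j) + of_nat k) + of_int (int (q $ j) - int k)"
        by (simp add: vmap_def)
      ultimately have vj: "v $ j = of_int (int (q $ j) - int k)" by (simp only: add_0_left)
      have "int (q $ j) = - u $ j" using k by (simp add: q_def vmap_def)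
      then have "v $ j + of_int (u $ j) = of_int (- int k)" using vj by simp
      then have "j \<in> nsupp (v + vmap of_int u)"
        using k(1) unfolding nsupp_iff by (intro exI[of _ "- int k"]) simp
      then obtain z where "z < 0" "v $ j = of_int z" using sub by (auto simp: nsupp_def)
      then have "z = int (q $ j) - int k" using vj by (simp only: of_int_eq_iff)
      with \<open>z < 0\<close> k(2) show False by simp
    qed
  qed
  with \<open>g 0 \<noteq> 0\<close> show False by simp
qed

theorem proposition6p2:
  fixes A :: "int ^ 'n ^ 'd"
    and w :: "real ^ 'n"
    and \<beta> :: "'k::field_char_0 ^ 'd"
    and v :: "'k ^ 'n"
  assumes "rank (map_matrix rat_of_int A) = CARD('d)"
    and "homogeneous_columns A"
    and "\<exists>r. r simplex (conv_columns A)"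
    and "generic_weight A \<beta> w"
    and "regular_triangulation A w = {F. F face_of conv_columns A}"
    and "fake_exponent A \<beta> w v"
    and "\<not> minimal_negative_support A v"
  shows "\<not> exponent A \<beta> w v"
proof
  assume "exponent A \<beta> w v"
  then obtain g where series: "hypergeometric_series A \<beta> v g" and "g 0 \<noteq> 0"
    and dir: "in_direction w g"
    by (auto simp: exponent_def)
  obtain r where r: "r simplex conv_columns A" using assms(3) ..
  obtain I c where le: "\<And>j. c \<bullet> real_column A j \<le> w $ j"
    and eq: "\<And>j. j \<in> I \<Longrightarrow> c \<bullet> real_column A j = w $ j"
    and inj: "inj_on (real_column A) I" and aff: "\<not> affine_dependent (real_column A ` I)"
    and hull: "conv_columns A = convex hull (real_column A ` I)"
    by (rule simplex_triangulation_vertices[OF r assms(5)]) blast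
  obtain M l where M: "M > 0"
    and dual: "\<And>i j. i \<in> I \<Longrightarrow> j \<in> I \<Longrightarrow> (\<Sum>r\<in>UNIV. l i $ r * A $ r $ j) = (if i = j then M else 0)"
    by (rule dual_rows[OF affine_independent_columns_imp_independent[OF assms(2) inj aff]]) blast
  have off: "mpoly_pderiv j (g u) = 0" if j: "j \<notin> I" for j u
  proof -
    have "real_column A j \<in> conv_columns A" by (simp add: conv_columns_def hull_inc)
    then have "real_column A j \<in> convex hull (real_column A ` I)" by (simp only: hull)
    then obtain n where rel: "A *v axis j M = A *v vmap int n" and n: "\<And>i. i \<notin> I \<Longrightarrow> n $ i = 0"
      using column_relation[OF dual M _ inj] by blast
    define b where "b = axis j M - vmap int n"
    have "b $ j = M" using n[OF j] by (simp add: b_def vmap_def axis_component)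
    with M have "b \<noteq> 0" by auto
    moreover have "0 \<le> w \<bullet> vmap real_of_int b"
    proof -
      \<comment> \<open>$w$ is bounded below by the linear form $c$, with equality on \<open>I\<close>; $b$ is negative at most
         on \<open>I\<close>, and the linear form vanishes on $b \in L$\<close>
      have comp: "(\<Sum>i\<in>UNIV. A $ s $ i * b $ i) = 0" for s
        using arg_cong[OF rel, of "\<lambda>x. x $ s"]
        by (simp add: matrix_vector_mult_def b_def right_diff_distrib sum_subtractf)
      have "(\<Sum>i\<in>UNIV. (c \<bullet> real_column A i) * of_int (b $ i))
          = (\<Sum>i\<in>UNIV. \<Sum>s\<in>UNIV. c $ s * of_int (A $ s $ i * b $ i))"
        by (simp add: inner_vec_def sum_distrib_right mult.assoc)
      also have "\<dots> = (\<Sum>s\<in>UNIV. c $ s * of_int (\<Sum>i\<in>UNIV. A $ s $ i * b $ i))"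
        by (subst sum.swap) (simp add: sum_distrib_left)
      finally have "0 = (\<Sum>i\<in>UNIV. (c \<bullet> real_column A i) * of_int (b $ i))"
        by (simp add: comp)
      also have "\<dots> \<le> (\<Sum>i\<in>UNIV. w $ i * of_int (b $ i))"
      proof (rule sum_mono)
        fix i
        show "(c \<bullet> real_column A i) * of_int (b $ i) \<le> w $ i * of_int (b $ i)"
        proof (cases "i \<in> I")
          case True
          then show ?thesis by (simp add: eq)
        next
          case False
          then have "0 \<le> b $ i" using n[OF False] M by (simp add: b_def vmap_def axis_component)
          with le[of i] show ?thesis by (simp add: mult_right_mono)
        qed
      qed
      finally show ?thesis by (simp add: inner_vec_def vmap_def)
    qed
    ultimately have "\<exists>k. g (u - int k *s b) = 0"
      by (rule in_direction_eventually_vanishes[OF dir])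
    then show ?thesis
      using log_x_derivative_vanishes[OF series, of j "nat M" n u] rel M by (simp add: b_def)
  qed
  have "mpoly_pderiv i (g u) = 0" for i u
    by (rule Euler_equations_imp_derivatives_vanish[OF dual M series off])
  then have "minimal_negative_support A v"
    by (rule log_free_series_minimal_negative_support[OF series _ \<open>g 0 \<noteq> 0\<close>])
  with assms(7) show False ..
qed

end
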